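(* Let $u\ge1$, $q,v,r,s>0$, $0\le\theta\le1$, and $\alpha_1,\alpha_2,\alpha_3,\sigma\in\mathbb{R}$ satisfy $n+\alpha_2>0$, $\frac nu+\alpha_3>0$, $\frac nq+\alpha_1>0$, $\sigma\le\alpha_2\le\sigma+1$, $\alpha_1=\theta\sigma+(1-\theta)\alpha_3$, $\frac nq+\alpha_1=\theta(n+\alpha_2-1)+(\frac nu+\alpha_3)(1-\theta)$ and $\frac1r=\frac\theta s+\frac{1-\theta}v$. Then there is $c>0$ such that $$\|f\|_{\dot K_q^{\alpha_1,r}(\mathbb{R}^n)}\le c\,\|\nabla f\|_{\dot K_1^{\alpha_2,s}(\mathbb{R}^n)}^{\theta}\,\|f\|_{\dot K_u^{\alpha_3,v}(\mathbb{R}^n)}^{1-\theta}\quad\text{for all } f\in C^1(\mathbb{R}^n).$$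
   Context: For $k\in\mathbb{Z}$ let $C_k=\{x\in\mathbb{R}^n: 2^{k-1}\le |x|<2^k\}$ and $\chi_k$ its characteristic function. For $\alpha\in\mathbb{R}$ and $0<p,q\le\infty$, $\|f\|_{\dot K_p^{\alpha,q}(\mathbb{R}^n)}=\big(\sum_{k\in\mathbb{Z}}2^{k\alpha q}\|f\chi_k\|_{L^p}^q\big)^{1/q}$ (usual modification if $q=\infty$); for the gradient, $\|\nabla f\|_{\dot K_p^{\alpha,q}}$ means $\||\nabla f|\|_{\dot K_p^{\alpha,q}}$.
   Formalization: The inequality is proved for f in C^1 whose two right-hand norms are both finite; without this it fails or is undefined for nonzero constants, e.g. f=1 with θ=1, where the gradient norm is 0 and the left side is infinite. *)

theory Defs
  imports "HOL-Analysis.Analysis"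
begin

text \<open>Real power of an extended nonnegative real, for positive exponents
  (infinity is mapped to infinity).\<close>
definition epowr :: "ennreal \<Rightarrow> real \<Rightarrow> ennreal" where
  "epowr x a = (if x = top then top else ennreal (enn2real x powr a))"

definition annulus :: "int \<Rightarrow> 'a::euclidean_space set" where
  "annulus k = {x. 2 powr (real_of_int k - 1) \<le> norm x \<and> norm x < 2 powr (real_of_int k)}"

definition lp_norm :: "real \<Rightarrow> 'a::euclidean_space set \<Rightarrow> ('a \<Rightarrow> real) \<Rightarrow> ennreal" where
  "lp_norm p A f = epowr (\<integral>\<^sup>+ x\<in>A. ennreal (\<bar>f x\<bar> powr p) \<partial>lborel) (1 / p)"

definition herz_norm :: "real \<Rightarrow> real \<Rightarrow> real \<Rightarrow> ('a::euclidean_space \<Rightarrow> real) \<Rightarrow> ennreal" where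
  "herz_norm \<alpha> p q f =
     epowr (\<Sum>\<^sub>\<infinity> k\<in>(UNIV::int set).
              ennreal (2 powr (real_of_int k * \<alpha> * q)) * epowr (lp_norm p (annulus k) f) q) (1 / q)"

end

theory Submission
  imports Defs
begin

text \<open>
  The relations between the parameters say that \<open>1/q = \<theta>w + (1 - \<theta>)/u\<close> with
  \<open>w = (n - 1 + \<alpha>2 - \<sigma>)/n \<ge> (n - 1)/n\<close>, so on a bounded region the \<open>L\<^sup>q\<close> norm is
  controlled by interpolating between \<open>L\<^sup>u\<close> and the Sobolev inequality for gradients in
  \<open>L\<^sup>1\<close>; the latter follows on cubes from a Loomis-Whitney inequality. It is applied to
  \<open>f - f(2x)\<close>, whose \<open>L\<^sup>1\<close> norm on an annulus is bounded by that of the gradient on the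
  neighbouring annuli. This bounds the change of \<open>f\<close> from one annulus to the next. Since
  \<open>n/q + \<alpha>1 > 0\<close>, the resulting recursion can be iterated towards infinity, where \<open>f\<close>
  decays, and summed as a geometric series; no sign condition on \<open>n - 1 + \<alpha>2\<close> is involved.
  Hoelder's inequality for sequences concludes. The convention \<open>0 powr 0 = 0\<close> is compatible
  with every step, so the endpoints \<open>\<theta> = 0\<close> and \<open>\<theta> = 1\<close> need no separate treatment.
\<close>

section \<open>Powers of extended nonnegative reals and the Hoelder inequality\<close>

text \<open>The gradient means by themselves cannot be summed over the annuli, since their weight
  \<open>n - 1 + \<alpha>2\<close> may be zero or negative. The recursion therefore never separates
  them from f: its error term is already a product of gradient and function means with the exponents
  \<theta> and 1 - \<theta>, and this product carries exactly the positive weight n/q + \<alpha>1.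
  The local inequality for f itself leaves a lower-order L1 term of f beside the gradient, which is
  too large; the dilation difference has no such term. The price is the term f(2x), and its
  coefficient must be close to 1: a quasi-triangle constant could exceed the gain per step, which is
  small when n/q + \<alpha>1 is small. All such losses are put on the error instead. The inequality
  with the lower-order term still serves for one purpose, to show that the iterated term tends to 0
  at infinity. This needs n/u + \<alpha>3 > 0 and u \<ge> 1, but only a limit is taken, so its
  constant does not enter the final one. All estimates are made on 1/2 \<le> |x| < 1 and dilated, so
  their constants do not depend on the annulus.\<close>

lemma epowr_top [simp]: "epowr top a = top"
  by (simp add: epowr_def)

lemma epowr_0 [simp]: "epowr 0 a = 0"
  by (simp add: epowr_def)

lemma epowr_ennreal: "0 \<le> x \<Longrightarrow> epowr (ennreal x) a = ennreal (x powr a)"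
  by (simp add: epowr_def)

lemma epowr_eq_0_iff [simp]: "epowr x a = 0 \<longleftrightarrow> x = 0"
  by (cases x) (auto simp: epowr_ennreal)

lemma epowr_eq_top_iff [simp]: "epowr x a = top \<longleftrightarrow> x = top"
  by (cases x) (auto simp: epowr_ennreal)

lemma epowr_1 [simp]: "epowr x 1 = x"
  by (cases x) (auto simp: epowr_ennreal)

lemma epowr_one [simp]: "epowr 1 a = 1"
  using epowr_ennreal[of 1 a] by simp

lemma epowr_mono: "x \<le> y \<Longrightarrow> 0 \<le> a \<Longrightarrow> epowr x a \<le> epowr y a"
  by (cases x; cases y) (auto simp: epowr_ennreal top_unique intro!: ennreal_leI powr_mono2)

lemma epowr_epowr: "epowr (epowr x a) b = epowr x (a * b)"
  by (cases x) (auto simp: epowr_ennreal powr_powr)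

text \<open>Since 0 and top are fixed by every exponent, including 0 and negative ones, the exponent
  laws hold with no side condition; only monotonicity needs the sign of the exponent.\<close>

lemma epowr_add: "epowr x (a + b) = epowr x a * epowr x b"
  by (cases x) (auto simp: epowr_ennreal powr_add ennreal_mult)

lemma epowr_mult: "epowr (x * y) a = epowr x a * epowr y a"
proof (cases "x = 0 \<or> y = 0")
  case False
  then show ?thesis
    by (cases x; cases y)
      (auto simp: epowr_ennreal powr_mult ennreal_mult[symmetric] ennreal_mult_top ennreal_top_mult)
qed auto

lemma epowr_prod: "epowr (\<Prod>i\<in>I. x i) a = (\<Prod>i\<in>I. epowr (x i) a)"
  by (induction I rule: infinite_finite_induct) (auto simp: epowr_mult)

text \<open>The case \<open>n = 0\<close> must be excluded: \<open>x ^ 0\<close> is 1 also at 0 and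
  top, where \<open>epowr x 0\<close> is 0 and top.\<close>

lemma epowr_power: "epowr x a ^ n = epowr x (real n * a)" if "n \<noteq> 0"
  using that
proof (induction n)
  case (Suc n)
  then show ?case
    by (cases "n = 0") (auto simp: epowr_add[symmetric] algebra_simps)
qed simp

lemma borel_measurable_epowr [measurable]:
  assumes [measurable]: "f \<in> borel_measurable M"
  shows "(\<lambda>x. epowr (f x) a) \<in> borel_measurable M"
  unfolding epowr_def by measurable

text \<open>Jensen's inequality for \<open>exp\<close> at the points \<open>ln (x i)\<close>. A
  vanishing factor is treated apart, since it is no value of \<open>exp\<close>; it makes the
  product 0 even if its exponent is 0, because \<open>0 powr 0 = 0\<close>.\<close>

lemma weighted_arith_geo_mean:
  fixes x a :: "'i \<Rightarrow> real"
  assumes "finite I" "\<And>i. i \<in> I \<Longrightarrow> 0 \<le> a i" "\<And>i. i \<in> I \<Longrightarrow> 0 \<le> x i" "(\<Sum>i\<in>I. a i) = 1"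
  shows "(\<Prod>i\<in>I. x i powr a i) \<le> (\<Sum>i\<in>I. a i * x i)"
proof (cases "\<exists>i\<in>I. x i = 0")
  case True
  then have "(\<Prod>i\<in>I. x i powr a i) = 0"
    using assms(1) by (auto intro!: prod_zero)
  also have "\<dots> \<le> (\<Sum>i\<in>I. a i * x i)"
    using assms by (intro sum_nonneg) auto
  finally show ?thesis .
next
  case False
  then have pos: "\<And>i. i \<in> I \<Longrightarrow> 0 < x i"
    using assms(3) by (force simp: order_less_le)
  have "(\<Prod>i\<in>I. x i powr a i) = exp (\<Sum>i\<in>I. a i * ln (x i))"
    using pos[THEN less_imp_neq] by (auto simp: exp_sum[OF assms(1)] powr_def intro!: prod.cong)
  also have "\<dots> \<le> (\<Sum>i\<in>I. a i * exp (ln (x i)))"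
    using convex_on_sum[of I UNIV exp "\<lambda>i. a i" "\<lambda>i. ln (x i)"] assms exp_convex
    by (cases "I = {}") auto
  also have "\<dots> = (\<Sum>i\<in>I. a i * x i)"
    using pos by (intro sum.cong) auto
  finally show ?thesis .
qed

text \<open>Each factor is divided by its integral and the weighted mean inequality is applied
  pointwise. The conventions for \<open>epowr\<close> settle the extreme cases for exponent 0 as
  well: a factor with zero integral makes both sides 0, and otherwise an infinite integral makes the
  right side infinite.\<close>

theorem nn_integral_Holder:
  fixes F :: "'i \<Rightarrow> 'b \<Rightarrow> ennreal"
  assumes fin: "finite I" and a: "\<And>i. i \<in> I \<Longrightarrow> 0 \<le> a i" "(\<Sum>i\<in>I. a i) = 1"
    and [measurable]: "\<And>i. i \<in> I \<Longrightarrow> F i \<in> borel_measurable M"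
  shows "(\<integral>\<^sup>+x. (\<Prod>i\<in>I. epowr (F i x) (a i)) \<partial>M) \<le> (\<Prod>i\<in>I. epowr (\<integral>\<^sup>+x. F i x \<partial>M) (a i))"
proof -
  consider i where "i \<in> I" "(\<integral>\<^sup>+x. F i x \<partial>M) = 0"
    | j where "\<And>i. i \<in> I \<Longrightarrow> (\<integral>\<^sup>+x. F i x \<partial>M) \<noteq> 0" "j \<in> I" "(\<integral>\<^sup>+x. F j x \<partial>M) = top"
    | "\<And>i. i \<in> I \<Longrightarrow> (\<integral>\<^sup>+x. F i x \<partial>M) \<noteq> 0" "\<And>i. i \<in> I \<Longrightarrow> (\<integral>\<^sup>+x. F i x \<partial>M) \<noteq> top"
    by blast
  then show ?thesis
  proof cases
    case 1
    then have "AE x in M. F i x = 0"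
      by (subst (asm) nn_integral_0_iff_AE) auto
    then have "AE x in M. (\<Prod>i\<in>I. epowr (F i x) (a i)) = 0"
      by eventually_elim (use 1 fin in auto)
    then have "(\<integral>\<^sup>+x. (\<Prod>i\<in>I. epowr (F i x) (a i)) \<partial>M) = (\<integral>\<^sup>+x. 0 \<partial>M)"
      by (rule nn_integral_cong_AE)
    then show ?thesis by simp
  next
    case 2
    then have "(\<Prod>i\<in>I. epowr (\<integral>\<^sup>+x. F i x \<partial>M) (a i)) = top"
      using fin by (auto simp: ennreal_prod_eq_top)
    then show ?thesis by simp
  next
    case 3
    define c where "c i = enn2real (\<integral>\<^sup>+x. F i x \<partial>M)" for i
    have c: "(\<integral>\<^sup>+x. F i x \<partial>M) = ennreal (c i)" "0 < c i" if "i \<in> I" for i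
      using 3[OF that] by (auto simp: c_def ennreal_enn2real_if enn2real_positive_iff less_top zero_less_iff_neq_zero)
    \<comment> \<open>The right side of the claim as a real number. The factors divided by
      \<open>c i\<close> have integral 1, so the mean inequality integrates to \<open>C\<close>
      times the sum of the weights.\<close>
    define C where "C = (\<Prod>i\<in>I. c i powr a i)"
    have C0: "C > 0" unfolding C_def using c(2)[THEN less_imp_neq] by (auto intro!: prod_pos)
    have "AE x in M. \<forall>i\<in>I. F i x \<noteq> top"
      using 3 by (intro AE_finite_allI fin nn_integral_noteq_infinite[simplified]) auto
    then have "AE x in M. (\<Prod>i\<in>I. epowr (F i x) (a i))
        \<le> (\<Sum>i\<in>I. ennreal (C * a i / c i) * F i x)"
    proof eventually_elim
      case (elim x)
      define y where "y i = enn2real (F i x)" for i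
      have y: "F i x = ennreal (y i)" "0 \<le> y i" if "i \<in> I" for i
        using elim that by (auto simp: y_def ennreal_enn2real_if)
      have "(\<Prod>i\<in>I. epowr (F i x) (a i)) = ennreal (\<Prod>i\<in>I. y i powr a i)"
        using y by (subst prod_ennreal[symmetric]) (auto simp: epowr_ennreal intro!: prod.cong)
      also have "(\<Prod>i\<in>I. y i powr a i) = C * (\<Prod>i\<in>I. (y i / c i) powr a i)"
        unfolding C_def prod.distrib[symmetric] using y c
        by (intro prod.cong refl) (auto simp: powr_divide less_imp_le dest!: c(2))
      also have "\<dots> \<le> C * (\<Sum>i\<in>I. a i * (y i / c i))"
        using C0 fin a y c by (intro mult_left_mono weighted_arith_geo_mean) (auto intro!: divide_nonneg_pos)
      also have "\<dots> = (\<Sum>i\<in>I. (C * a i / c i) * y i)"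
        by (auto simp: sum_distrib_left algebra_simps)
      also have "ennreal \<dots> = (\<Sum>i\<in>I. ennreal ((C * a i / c i) * y i))"
        using C0 a y c by (subst sum_ennreal) (auto intro!: mult_nonneg_nonneg divide_nonneg_pos)
      also have "\<dots> = (\<Sum>i\<in>I. ennreal (C * a i / c i) * F i x)"
        using y by (intro sum.cong refl) (metis ennreal_mult'')
      finally show ?case by (simp add: ennreal_leI)
    qed
    then have "(\<integral>\<^sup>+x. (\<Prod>i\<in>I. epowr (F i x) (a i)) \<partial>M)
        \<le> (\<integral>\<^sup>+x. (\<Sum>i\<in>I. ennreal (C * a i / c i) * F i x) \<partial>M)"
      by (rule nn_integral_mono_AE)
    also have "\<dots> = (\<Sum>i\<in>I. ennreal (C * a i / c i) * ennreal (c i))"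
      by (subst nn_integral_sum) (auto simp: nn_integral_cmult c intro!: sum.cong)
    also have "\<dots> = (\<Sum>i\<in>I. ennreal (C * a i))"
    proof (intro sum.cong refl)
      fix i assume i: "i \<in> I"
      show "ennreal (C * a i / c i) * ennreal (c i) = ennreal (C * a i)"
        using c(2)[OF i] C0 a(1)[OF i] by (subst ennreal_mult[symmetric]) auto
    qed
    also have "\<dots> = ennreal C"
      using a C0 by (subst sum_ennreal) (auto simp: sum_distrib_left[symmetric])
    also have "\<dots> = (\<Prod>i\<in>I. epowr (\<integral>\<^sup>+x. F i x \<partial>M) (a i))"
      unfolding C_def using c
      by (subst prod_ennreal[symmetric]) (auto simp: epowr_ennreal less_imp_le intro!: prod.cong)
    finally show ?thesis .
  qed
qed

corollary nn_integral_Holder2: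
  assumes a: "0 \<le> a" "0 \<le> b" "a + b = 1"
    and [measurable]: "F \<in> borel_measurable M" "G \<in> borel_measurable M"
  shows "(\<integral>\<^sup>+x. epowr (F x) a * epowr (G x) b \<partial>M)
    \<le> epowr (\<integral>\<^sup>+x. F x \<partial>M) a * epowr (\<integral>\<^sup>+x. G x \<partial>M) b"
  using nn_integral_Holder[of "{True,False}" "\<lambda>i. if i then a else b" "\<lambda>i. if i then F else G" M] assms
  by simp

section \<open>A Loomis-Whitney inequality on products of probability spaces\<close>

text \<open>The missing weight \<open>1 - a * card I\<close> goes to the constant function 1, stored
  under the extra index \<open>None\<close>; its integral is 1 because the total mass is.\<close>

lemma nn_integral_Holder_prob:
  fixes F :: "'i \<Rightarrow> 'b \<Rightarrow> ennreal"
  assumes fin: "finite I" and a: "0 \<le> a" "a * real (card I) \<le> 1"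
    and M: "emeasure M (space M) = 1"
    and F: "\<And>i. i \<in> I \<Longrightarrow> F i \<in> borel_measurable M"
  shows "(\<integral>\<^sup>+x. (\<Prod>i\<in>I. epowr (F i x) a) \<partial>M) \<le> (\<Prod>i\<in>I. epowr (\<integral>\<^sup>+x. F i x \<partial>M) a)"
proof -
  let ?I = "insert None (Some ` I)"
  let ?a = "case_option (1 - a * card I) (\<lambda>_. a)"
  let ?F = "case_option (\<lambda>_. 1) F"
  have "(\<integral>\<^sup>+x. (\<Prod>i\<in>?I. epowr (?F i x) (?a i)) \<partial>M) \<le> (\<Prod>i\<in>?I. epowr (\<integral>\<^sup>+x. ?F i x \<partial>M) (?a i))"
    using assms by (intro nn_integral_Holder) (auto simp: sum.reindex algebra_simps)
  then show ?thesis
    using fin M by (simp add: prod.reindex)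
qed

lemma (in product_sigma_finite) emeasure_space_PiM_eq_1:
  assumes "finite I" "\<And>i. emeasure (M i) (space (M i)) = 1"
  shows "emeasure (PiM I M) (space (PiM I M)) = 1"
  unfolding space_PiM using assms by (subst emeasure_PiM) auto

text \<open>Induction on the number of coordinates, slicing along the new coordinate j. The
  classical exponent is \<open>1 / (card I - 1)\<close>; on probability spaces all smaller
  nonnegative ones are admissible too, so subcritical Sobolev exponents need no extra
  argument.\<close>

theorem (in product_sigma_finite) Loomis_Whitney_prob:
  fixes F :: "'i \<Rightarrow> ('i \<Rightarrow> 'a) \<Rightarrow> ennreal"
  assumes "finite I" "I \<noteq> {}"
    and prob: "\<And>i. emeasure (M i) (space (M i)) = 1"
    and "\<And>i. i \<in> I \<Longrightarrow> F i \<in> borel_measurable (PiM I M)"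
    and "\<And>i x t. i \<in> I \<Longrightarrow> x \<in> space (PiM I M) \<Longrightarrow> t \<in> space (M i) \<Longrightarrow> F i (x(i := t)) = F i x"
    and "0 \<le> a" "a * (real (card I) - 1) \<le> 1"
  shows "(\<integral>\<^sup>+x. (\<Prod>i\<in>I. epowr (F i x) a) \<partial>PiM I M) \<le> (\<Prod>i\<in>I. epowr (\<integral>\<^sup>+x. F i x \<partial>PiM I M) a)"
  using assms(1,2,4-)
proof (induction I arbitrary: F a rule: finite_ne_induct)
  case (singleton j)
  let ?P = "PiM {j} M"
  have P: "emeasure ?P (space ?P) = 1"
    using prob by (intro emeasure_space_PiM_eq_1) auto
  then obtain x0 where x0: "x0 \<in> space ?P"
    by (metis emeasure_empty equals0I zero_neq_one)
  have const: "F j x = F j x0" if "x \<in> space ?P" for x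
  proof -
    have "x = x0(j := x j)"
      using that x0 by (auto simp: space_PiM PiE_def extensional_def)
    moreover have "x j \<in> space (M j)"
      using that by (auto simp: space_PiM)
    ultimately show ?thesis
      using singleton.prems(2)[of j x0 "x j"] x0 by auto
  qed
  have "(\<integral>\<^sup>+x. epowr (F j x) a \<partial>?P) = (\<integral>\<^sup>+x. epowr (F j x0) a \<partial>?P)"
    by (intro nn_integral_cong) (auto simp: const)
  moreover have "(\<integral>\<^sup>+x. F j x \<partial>?P) = (\<integral>\<^sup>+x. F j x0 \<partial>?P)"
    by (intro nn_integral_cong) (auto simp: const)
  ultimately show ?case
    using P by simp
next
  case (insert j J)
  interpret J: finite_product_sigma_finite M J
    by standard (use insert in auto)
  let ?P = "PiM J M" and ?I = "insert j J"
  note [measurable] = insert.prems(1)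
  have I: "card ?I = Suc (card J)" using insert by simp
  have P: "emeasure ?P (space ?P) = 1"
    using prob insert by (intro emeasure_space_PiM_eq_1) auto
  then obtain x0 where x0: "x0 \<in> space ?P"
    by (metis emeasure_empty equals0I zero_neq_one)
  obtain t0 where t0: "t0 \<in> space (M j)"
    using prob[of j] by (metis emeasure_empty equals0I zero_neq_one)
  have upd: "x(j := t) \<in> space (PiM ?I M)" if "x \<in> space ?P" "t \<in> space (M j)" for x t
    using that by (auto simp: space_PiM PiE_def extensional_def)
  have aJ: "a * card J \<le> 1" using insert.prems(4) I by simp
  have cJ: "card J \<ge> 1" using insert by (simp add: Suc_le_eq card_gt_0_iff)
  have a1: "a \<le> 1"
    using aJ mult_left_mono[of 1 "real (card J)" a] cJ insert.prems(3) by simp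
  have pm [measurable]: "(\<lambda>z. F i ((fst z)(j := snd z))) \<in> borel_measurable (?P \<Otimes>\<^sub>M M j)"
    if "i \<in> ?I" for i
    using measurable_compose[OF measurable_add_dim insert.prems(1)[OF that]]
    by (simp add: case_prod_beta' fun_upd_def)
  have mt [measurable]: "(\<lambda>x. F i (x(j := t))) \<in> borel_measurable ?P"
    if "t \<in> space (M j)" "i \<in> ?I" for t i
    using measurable_compose[OF measurable_Pair2'[OF that(1)] pm[OF that(2)]] by simp
  \<comment> \<open>\<open>A i t\<close> is the integral of \<open>F i\<close> over the slice on
    which coordinate j equals t. For \<open>i = j\<close> it is the same number \<open>E\<close> on
    every slice.\<close>
  define A where "A i t = (\<integral>\<^sup>+x. F i (x(j := t)) \<partial>?P)" for i t
  have pm': "(\<lambda>z. F i ((snd z)(j := fst z))) \<in> borel_measurable (M j \<Otimes>\<^sub>M ?P)"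
    if "i \<in> ?I" for i
    using measurable_compose[OF measurable_pair_swap' pm[OF that]] by (simp add: case_prod_beta')
  have mA: "A i \<in> borel_measurable (M j)" if "i \<in> ?I" for i
    unfolding A_def using J.borel_measurable_nn_integral_fst[OF pm'[OF that]] by simp
  have intA: "(\<integral>\<^sup>+x. F i x \<partial>PiM ?I M) = (\<integral>\<^sup>+t. A i t \<partial>M j)" if "i \<in> ?I" for i
    unfolding A_def using insert that by (intro product_nn_integral_insert_rev) auto
  have Fj: "F j (x(j := t)) = F j (x(j := t0))" if "x \<in> space ?P" "t \<in> space (M j)" for x t
    using insert.prems(2)[OF insertI1 upd[OF that(1) t0] that(2)] by (metis fun_upd_upd)
  define E where "E = A j t0"
  have E: "A j t = E" if "t \<in> space (M j)" for t
    unfolding A_def E_def by (intro nn_integral_cong Fj that)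
  have E': "(\<integral>\<^sup>+x. F j x \<partial>PiM ?I M) = E"
  proof -
    have "(\<integral>\<^sup>+x. F j x \<partial>PiM ?I M) = (\<integral>\<^sup>+t. E \<partial>M j)"
      unfolding intA[OF insertI1] by (intro nn_integral_cong E)
    then show ?thesis using prob by simp
  qed
  have indep: "F i ((x(i := s))(j := t)) = F i (x(j := t))"
    if "i \<in> J" "x \<in> space ?P" "s \<in> space (M i)" "t \<in> space (M j)" for i x s t
    using insert.prems(2)[OF insertI2[OF that(1)] upd[OF that(2,4)] that(3)] that(1) insert(3)
    by (metis fun_upd_twist)
  have slice: "(\<integral>\<^sup>+x. epowr (F j (x(j := t))) a * (\<Prod>i\<in>J. epowr (F i (x(j := t))) a) \<partial>?P)
      \<le> epowr E a * (\<Prod>i\<in>J. epowr (A i t) a)" if t: "t \<in> space (M j)" for t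
  \<comment> \<open>The Hoelder weights on the slice are a and \<open>1 - a\<close>. For
    \<open>a = 1\<close> the second one degenerates, but then \<open>J\<close> has a single element,
    its function is constant on the slice and the integral factors exactly.\<close>
  proof (cases "a = 1")
    case True
    then have "card J = 1" using aJ cJ by simp
    then obtain i where J: "J = {i}" by (auto simp: card_1_singleton_iff)
    have const: "F i (x(j := t)) = F i (x0(j := t))" if "x \<in> space ?P" for x
    proof -
      have "x = x0(i := x i)"
        using that x0 by (auto simp: space_PiM PiE_def extensional_def J)
      moreover have "x i \<in> space (M i)"
        using that by (auto simp: space_PiM J)
      ultimately show ?thesis
        using indep[of i x0 "x i" t] x0 t J by auto
    qed
    have "A i t = (\<integral>\<^sup>+x. F i (x0(j := t)) \<partial>?P)"
      unfolding A_def by (intro nn_integral_cong const)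
    then have Ai: "A i t = F i (x0(j := t))" using P by simp
    have "(\<integral>\<^sup>+x. F j (x(j := t)) * F i (x(j := t)) \<partial>?P)
        = (\<integral>\<^sup>+x. F j (x(j := t)) * A i t \<partial>?P)"
      by (intro nn_integral_cong) (simp add: Ai const)
    also have "\<dots> = A j t * A i t"
      using t by (subst nn_integral_multc) (auto simp: A_def)
    finally show ?thesis
      using True E[OF t] by (simp add: J)
  next
    case False
    \<comment> \<open>Chosen so that \<open>b * (1 - a) = a\<close>. The bound
      \<open>a * card J \<le> 1\<close> turns into the admissibility of b for \<open>J\<close>,
      which has one coordinate fewer.\<close>
    define b where "b = a / (1 - a)"
    have b: "0 \<le> b" "b * (1 - a) = a" "b * (real (card J) - 1) \<le> 1"
      using False a1 insert.prems(3) aJ by (auto simp: b_def field_simps)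
    have IH: "(\<integral>\<^sup>+x. (\<Prod>i\<in>J. epowr (F i (x(j := t))) b) \<partial>?P) \<le> (\<Prod>i\<in>J. epowr (A i t) b)"
      unfolding A_def
    proof (rule insert.IH)
      show "(\<lambda>x. F i (x(j := t))) \<in> borel_measurable ?P" if "i \<in> J" for i
        using mt[OF t insertI2[OF that]] .
      show "F i (x(i := s, j := t)) = F i (x(j := t))"
        if "i \<in> J" "x \<in> space ?P" "s \<in> space (M i)" for i x s
        using indep[OF that t] .
    qed (use b in auto)
    have "(\<integral>\<^sup>+x. epowr (F j (x(j := t))) a * (\<Prod>i\<in>J. epowr (F i (x(j := t))) a) \<partial>?P)
        = (\<integral>\<^sup>+x. epowr (F j (x(j := t))) a * epowr (\<Prod>i\<in>J. epowr (F i (x(j := t))) b) (1 - a) \<partial>?P)"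
      using b by (simp add: epowr_prod epowr_epowr)
    also have "\<dots> \<le> epowr (A j t) a * epowr (\<integral>\<^sup>+x. (\<Prod>i\<in>J. epowr (F i (x(j := t))) b) \<partial>?P) (1 - a)"
      unfolding A_def using a1 insert.prems(3) t by (intro nn_integral_Holder2) auto
    also have "\<dots> \<le> epowr (A j t) a * epowr (\<Prod>i\<in>J. epowr (A i t) b) (1 - a)"
      using a1 IH by (intro mult_left_mono epowr_mono) auto
    also have "\<dots> = epowr E a * (\<Prod>i\<in>J. epowr (A i t) a)"
      using b E[OF t] by (simp add: epowr_prod epowr_epowr)
    finally show ?thesis .
  qed
  have "(\<integral>\<^sup>+x. (\<Prod>i\<in>?I. epowr (F i x) a) \<partial>PiM ?I M)
      = (\<integral>\<^sup>+t. (\<integral>\<^sup>+x. (\<Prod>i\<in>?I. epowr (F i (x(j := t))) a) \<partial>?P) \<partial>M j)"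
    using insert by (intro product_nn_integral_insert_rev) auto
  also have "\<dots> \<le> (\<integral>\<^sup>+t. epowr E a * (\<Prod>i\<in>J. epowr (A i t) a) \<partial>M j)"
    using slice insert(1,3) by (intro nn_integral_mono) simp
  also have "\<dots> = epowr E a * (\<integral>\<^sup>+t. (\<Prod>i\<in>J. epowr (A i t) a) \<partial>M j)"
    using mA by (intro nn_integral_cmult) auto
  \<comment> \<open>What remains is a product of \<open>card J\<close> functions of t alone, and
    \<open>a * card J \<le> 1\<close> is the condition of Hoelder's inequality on a probability
    space.\<close>
  also have "\<dots> \<le> epowr E a * (\<Prod>i\<in>J. epowr (\<integral>\<^sup>+t. A i t \<partial>M j) a)"
    using mA insert aJ prob by (intro mult_left_mono nn_integral_Holder_prob) auto
  also have "\<dots> = (\<Prod>i\<in>?I. epowr (\<integral>\<^sup>+x. F i x \<partial>PiM ?I M) a)"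
    using insert(1,3) E' intA by simp
  finally show ?case .
qed

section \<open>Sobolev inequalities on cubes\<close>

lemma ennreal_abs_diff_le_line_integral:
  fixes h :: "'a::euclidean_space \<Rightarrow> real" and g :: "'a \<Rightarrow> 'a"
  assumes h: "\<And>x. GDERIV h x :> g x" and g: "continuous_on UNIV g"
    and st: "s \<in> {a..b}" "t \<in> {a..b}"
  shows "ennreal \<bar>h (z + s *\<^sub>R v) - h (z + t *\<^sub>R v)\<bar>
    \<le> (\<integral>\<^sup>+\<tau>\<in>{a..b}. ennreal (norm v * norm (g (z + \<tau> *\<^sub>R v))) \<partial>lborel)"
proof -
  define k where "k \<tau> = norm v * norm (g (z + \<tau> *\<^sub>R v))" for \<tau>
  have kcont: "continuous_on S k" for S
    unfolding k_def by (intro continuous_intros continuous_on_compose2[OF g]) auto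
  have kint: "k integrable_on {c..d}" for c d
    by (intro integrable_continuous_interval kcont)
  have k0: "0 \<le> k \<tau>" for \<tau> by (auto simp: k_def)
  have main: "\<bar>h (z + d *\<^sub>R v) - h (z + c *\<^sub>R v)\<bar> \<le> integral {a..b} k"
    if "c \<le> d" "a \<le> c" "d \<le> b" for c d
  proof -
    have "((\<lambda>\<tau>. h (z + \<tau> *\<^sub>R v)) has_vector_derivative (v \<bullet> g (z + \<tau> *\<^sub>R v))) (at \<tau> within {c..d})" for \<tau>
    proof -
      have "((\<lambda>\<tau>. h (z + \<tau> *\<^sub>R v)) has_derivative (\<lambda>x. (x *\<^sub>R v) \<bullet> g (z + \<tau> *\<^sub>R v))) (at \<tau> within {c..d})"
        by (rule has_derivative_compose[where g = h])
           (use h[of "z + \<tau> *\<^sub>R v"] in \<open>auto simp: gderiv_def intro!: derivative_eq_intros\<close>)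
      then show ?thesis by (simp add: has_vector_derivative_def)
    qed
    then have ftc: "((\<lambda>\<tau>. v \<bullet> g (z + \<tau> *\<^sub>R v)) has_integral (h (z + d *\<^sub>R v) - h (z + c *\<^sub>R v))) {c..d}"
      using that by (intro fundamental_theorem_of_calculus) auto
    have "\<bar>h (z + d *\<^sub>R v) - h (z + c *\<^sub>R v)\<bar> \<le> integral {c..d} k"
      unfolding integral_unique[OF ftc, symmetric] real_norm_def[symmetric]
      by (intro integral_norm_bound_integral kint has_integral_integrable[OF ftc])
         (auto simp: k_def Cauchy_Schwarz_ineq2)
    also have "\<dots> \<le> integral {a..b} k"
      using that by (intro integral_subset_le kint) (auto simp: k0)
    finally show ?thesis .
  qed
  have "\<bar>h (z + s *\<^sub>R v) - h (z + t *\<^sub>R v)\<bar> \<le> integral {a..b} k"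
    using main[of s t] main[of t s] st by (cases "s \<le> t") (auto simp: abs_minus_commute)
  then have "ennreal \<bar>h (z + s *\<^sub>R v) - h (z + t *\<^sub>R v)\<bar> \<le> ennreal (integral {a..b} k)"
    by (rule ennreal_leI)
  also have "\<dots> = (\<integral>\<^sup>+\<tau>. ennreal (indicator {a..b} \<tau> * k \<tau>) \<partial>lborel)"
    by (rule nn_integral_has_integral_lebesgue[symmetric]) (auto simp: k0 intro!: integrable_integral kint)
  also have "\<dots> = (\<integral>\<^sup>+\<tau>\<in>{a..b}. ennreal (k \<tau>) \<partial>lborel)"
    by (intro nn_integral_cong) (auto simp: indicator_def)
  finally show ?thesis by (simp add: k_def)
qed

lemma GDERIV_continuous_on:
  fixes h :: "'a::euclidean_space \<Rightarrow> real"
  assumes "\<And>x. GDERIV h x :> g x"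
  shows "continuous_on S h"
  using assms
  by (meson continuous_at_imp_continuous_on gderiv_def has_derivative_continuous)

text \<open>The value at s is at most the value at t plus the full line integral \<open>J\<close>.
  Averaging over t in an interval of length 1 removes t and leaves \<open>J\<close>
  unchanged.\<close>

lemma ennreal_abs_le_unit_line_integral:
  fixes h :: "'a::euclidean_space \<Rightarrow> real" and g :: "'a \<Rightarrow> 'a"
  assumes h: "\<And>x. GDERIV h x :> g x" and g: "continuous_on UNIV g"
    and s: "s \<in> {0..1}" and v: "norm v = 1"
  shows "ennreal \<bar>h (z + s *\<^sub>R v)\<bar>
    \<le> (\<integral>\<^sup>+t\<in>{0..1}. ennreal (\<bar>h (z + t *\<^sub>R v)\<bar> + norm (g (z + t *\<^sub>R v))) \<partial>lborel)"
proof -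
  have [measurable]: "h \<in> borel_measurable borel" "g \<in> borel_measurable borel"
    using GDERIV_continuous_on[OF h] g by (auto intro!: borel_measurable_continuous_onI)
  define J where "J = (\<integral>\<^sup>+t\<in>{0..1::real}. ennreal (norm (g (z + t *\<^sub>R v))) \<partial>lborel)"
  have "ennreal \<bar>h (z + s *\<^sub>R v)\<bar> \<le> ennreal \<bar>h (z + t *\<^sub>R v)\<bar> + J" if "t \<in> {0..1}" for t
  proof -
    have "ennreal \<bar>h (z + s *\<^sub>R v)\<bar> \<le> ennreal (\<bar>h (z + t *\<^sub>R v)\<bar> + \<bar>h (z + s *\<^sub>R v) - h (z + t *\<^sub>R v)\<bar>)"
      by (intro ennreal_leI) auto
    also have "\<dots> \<le> ennreal \<bar>h (z + t *\<^sub>R v)\<bar> + J"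
      using ennreal_abs_diff_le_line_integral[OF h g s that, of z v] v
      by (auto simp: J_def intro!: add_mono)
    finally show ?thesis .
  qed
  then have "(\<integral>\<^sup>+t\<in>{0..1::real}. ennreal \<bar>h (z + s *\<^sub>R v)\<bar> \<partial>lborel)
      \<le> (\<integral>\<^sup>+t\<in>{0..1}. (ennreal \<bar>h (z + t *\<^sub>R v)\<bar> + J) \<partial>lborel)"
    by (intro nn_integral_mono) (auto simp: indicator_def)
  also have "\<dots> = (\<integral>\<^sup>+t\<in>{0..1}. ennreal \<bar>h (z + t *\<^sub>R v)\<bar> \<partial>lborel) + J"
    by (simp add: distrib_right nn_integral_add nn_integral_cmult)
  also have "\<dots> = (\<integral>\<^sup>+t\<in>{0..1}. ennreal (\<bar>h (z + t *\<^sub>R v)\<bar> + norm (g (z + t *\<^sub>R v))) \<partial>lborel)"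
    unfolding J_def by (simp add: distrib_right nn_integral_add)
  finally show ?thesis by (subst (asm) nn_integral_cmult_indicator) auto
qed

text \<open>Writing the uniform law as a density keeps its \<open>space\<close> equal to the whole
  line, so updating a coordinate never leaves the product space. In return, points outside the cube
  occur as a null set.\<close>

abbreviation unif01 :: "real measure" where
  "unif01 \<equiv> density lborel (indicator {0..1})"

lemma emeasure_unif01: "emeasure unif01 (space unif01) = 1"
  by (simp add: emeasure_density)

interpretation unif01: product_sigma_finite "\<lambda>_::'i. unif01"
proof (rule product_sigma_finite.intro)
  show "sigma_finite_measure unif01"
    using finite_measureI[of unif01] emeasure_unif01 by (simp add: finite_measure_def)
qed

text \<open>Both measures give a box the product of the masses of its sides, which determines the
  product measure.\<close>

lemma PiM_unif01:
  assumes "finite I"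
  shows "PiM I (\<lambda>_. unif01) = density (PiM I (\<lambda>_. lborel)) (\<lambda>x. \<Prod>i\<in>I. indicator {0..1} (x i))"
proof (rule unif01.PiM_eqI[symmetric, OF assms])
  interpret lborel: product_sigma_finite "\<lambda>_::'a. lborel :: real measure" ..
  show "sets (density (PiM I (\<lambda>_. lborel)) (\<lambda>x. \<Prod>i\<in>I. indicator {0..1} (x i))) = sets (PiM I (\<lambda>_. unif01))"
    by (auto intro!: sets_PiM_cong)
  fix A :: "'a \<Rightarrow> real set" assume A: "\<And>i. i \<in> I \<Longrightarrow> A i \<in> sets unif01"
  then have [measurable]: "Pi\<^sub>E I A \<in> sets (PiM I (\<lambda>_. lborel))"
    using assms by (intro sets_PiM_I_finite) auto
  have "emeasure (density (PiM I (\<lambda>_. lborel)) (\<lambda>x. \<Prod>i\<in>I. indicator {0..1} (x i))) (Pi\<^sub>E I A)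
      = (\<integral>\<^sup>+x. (\<Prod>i\<in>I. indicator {0..1} (x i)) * indicator (Pi\<^sub>E I A) x \<partial>PiM I (\<lambda>_. lborel))"
    using assms by (subst emeasure_density) auto
  also have "\<dots> = (\<integral>\<^sup>+x. (\<Prod>i\<in>I. indicator {0..1} (x i) * indicator (A i) (x i)) \<partial>PiM I (\<lambda>_. lborel))"
  proof (intro nn_integral_cong)
    fix x :: "'a \<Rightarrow> real" assume x: "x \<in> space (PiM I (\<lambda>_. lborel))"
    have "indicator (Pi\<^sub>E I A) x = (\<Prod>i\<in>I. indicator (A i) (x i) :: ennreal)"
    proof (cases "\<forall>i\<in>I. x i \<in> A i")
      case True
      then show ?thesis using x by (auto simp: space_PiM PiE_def Pi_def)
    next
      case False
      then have "(\<Prod>i\<in>I. indicator (A i) (x i) :: ennreal) = 0"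
        using assms False by (intro prod_zero) (auto simp: indicator_eq_0_iff)
      moreover have "x \<notin> Pi\<^sub>E I A" using False by auto
      ultimately show ?thesis by simp
    qed
    then show "(\<Prod>i\<in>I. indicator {0..1} (x i)) * indicator (Pi\<^sub>E I A) x
      = (\<Prod>i\<in>I. indicator {0..1} (x i) * indicator (A i) (x i) :: ennreal)"
      by (simp add: prod.distrib)
  qed
  also have "\<dots> = (\<Prod>i\<in>I. \<integral>\<^sup>+x. indicator {0..1} x * indicator (A i) x \<partial>lborel)"
    using assms A by (intro lborel.product_nn_integral_prod) auto
  also have "\<dots> = (\<Prod>i\<in>I. emeasure unif01 (A i))"
    using A by (intro prod.cong refl) (auto simp: emeasure_density)
  finally show "emeasure (density (PiM I (\<lambda>_. lborel)) (\<lambda>x. \<Prod>i\<in>I. indicator {0..1} (x i))) (Pi\<^sub>E I A)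
    = (\<Prod>i\<in>I. emeasure unif01 (A i))" .
qed

section \<open>The unit cube in coordinates and averages over one coordinate\<close>

definition of_coords :: "('a \<Rightarrow> real) \<Rightarrow> 'a::euclidean_space" where
  "of_coords x = (\<Sum>b\<in>Basis. x b *\<^sub>R b)"

lemma of_coords_inner: "b \<in> Basis \<Longrightarrow> of_coords x \<bullet> b = x b"
  by (simp add: of_coords_def)

lemma of_coords_upd: "b \<in> Basis \<Longrightarrow> of_coords (x(b := t)) = of_coords (x(b := 0)) + t *\<^sub>R b"
  by (rule euclidean_eqI) (auto simp: of_coords_inner inner_add_left inner_Basis)

lemma measurable_of_coords [measurable]:
  "of_coords \<in> borel_measurable (PiM Basis (\<lambda>_::'a::euclidean_space. unif01))"
  unfolding of_coords_def by measurable

text \<open>Lebesgue measure is the image of the product measure under \<open>of_coords\<close>, and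
  the indicator of the cube is a product over the coordinates.\<close>

lemma nn_integral_unit_cube:
  fixes \<phi> :: "'a::euclidean_space \<Rightarrow> ennreal"
  assumes [measurable]: "\<phi> \<in> borel_measurable borel"
  shows "(\<integral>\<^sup>+x\<in>cbox 0 One. \<phi> x \<partial>lborel) = (\<integral>\<^sup>+x. \<phi> (of_coords x) \<partial>PiM Basis (\<lambda>_. unif01))"
proof -
  have [measurable]: "(of_coords :: _ \<Rightarrow> 'a) \<in> borel_measurable (PiM Basis (\<lambda>_. lborel))"
    unfolding of_coords_def by measurable
  have ind: "indicator (cbox 0 One) (of_coords x :: 'a) = (\<Prod>b\<in>Basis. indicator {0..1} (x b) :: ennreal)" for x
  proof (cases "\<forall>b\<in>(Basis :: 'a set). x b \<in> {0..1}")
    case True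
    then show ?thesis by (auto simp: mem_box of_coords_inner)
  next
    case False
    then have "(\<Prod>b\<in>(Basis :: 'a set). indicator {0..1} (x b) :: ennreal) = 0"
      by (intro prod_zero) (auto simp: indicator_eq_0_iff)
    with False show ?thesis by (auto simp: mem_box of_coords_inner)
  qed
  have "(\<integral>\<^sup>+x\<in>cbox 0 One. \<phi> x \<partial>lborel)
      = (\<integral>\<^sup>+x. \<phi> (of_coords x) * indicator (cbox 0 One) (of_coords x :: 'a) \<partial>PiM Basis (\<lambda>_. lborel))"
    by (subst lborel_eq, subst of_coords_def[symmetric], subst nn_integral_distr) auto
  also have "\<dots> = (\<integral>\<^sup>+x. \<phi> (of_coords x) \<partial>PiM Basis (\<lambda>_. unif01))"
    by (subst PiM_unif01) (auto simp: nn_integral_density ind mult.commute)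
  finally show ?thesis .
qed

text \<open>Fubini with coordinate i split off: the averaged function no longer depends on that
  coordinate, and integrating it over a probability factor changes nothing.\<close>

lemma (in product_sigma_finite) nn_integral_PiM_average_coordinate:
  assumes I: "finite I" "i \<in> I" and prob: "emeasure (M i) (space (M i)) = 1"
    and f: "f \<in> borel_measurable (PiM I M)"
    and f': "(\<lambda>x. \<integral>\<^sup>+t. f (x(i := t)) \<partial>M i) \<in> borel_measurable (PiM I M)"
  shows "(\<integral>\<^sup>+x. (\<integral>\<^sup>+t. f (x(i := t)) \<partial>M i) \<partial>PiM I M) = (\<integral>\<^sup>+x. f x \<partial>PiM I M)"
proof -
  obtain J where J: "I = insert i J" "i \<notin> J" "finite J"
    using I by (metis Set.set_insert finite_insert)
  have "(\<integral>\<^sup>+x. (\<integral>\<^sup>+t. f (x(i := t)) \<partial>M i) \<partial>PiM I M)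
      = (\<integral>\<^sup>+s. (\<integral>\<^sup>+x. (\<integral>\<^sup>+t. f ((x(i := s))(i := t)) \<partial>M i) \<partial>PiM J M) \<partial>M i)"
    using J f' by (simp only: J(1)) (rule product_nn_integral_insert_rev, auto)
  also have "\<dots> = (\<integral>\<^sup>+x. (\<integral>\<^sup>+t. f (x(i := t)) \<partial>M i) \<partial>PiM J M)"
    using prob by simp
  also have "\<dots> = (\<integral>\<^sup>+x. f x \<partial>PiM I M)"
    using J f by (simp only: J(1)) (rule product_nn_integral_insert[symmetric], auto)
  finally show ?thesis .
qed

text \<open>The update is a translation along b. In this form joint measurability in x and t is
  immediate.\<close>

lemma of_coords_upd_shift: "b \<in> Basis \<Longrightarrow> of_coords (x(b := t)) = of_coords x + (t - x b) *\<^sub>R b"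
  by (rule euclidean_eqI) (auto simp: of_coords_inner inner_add_left inner_Basis)

lemma borel_measurable_coordinate_average [measurable]:
  fixes \<phi> :: "'a::euclidean_space \<Rightarrow> ennreal"
  assumes [measurable]: "\<phi> \<in> borel_measurable borel" and i: "i \<in> Basis"
  shows "(\<lambda>x. \<integral>\<^sup>+t. \<phi> (of_coords (x(i := t))) \<partial>unif01) \<in> borel_measurable (PiM Basis (\<lambda>_. unif01))"
proof -
  have [measurable]: "(\<lambda>x. x i) \<in> borel_measurable (PiM Basis (\<lambda>_::'a. unif01))"
    using i measurable_component_singleton[of i Basis "\<lambda>_::'a. unif01"] by simp
  show ?thesis
    unfolding of_coords_upd_shift[OF i]
    by (rule sigma_finite_measure.borel_measurable_nn_integral[OF unif01.sigma_finite_measures]) measurable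
qed

lemma nn_integral_coordinate_average:
  fixes \<phi> :: "'a::euclidean_space \<Rightarrow> ennreal"
  assumes [measurable]: "\<phi> \<in> borel_measurable borel" and i: "i \<in> Basis"
  shows "(\<integral>\<^sup>+x. (\<integral>\<^sup>+t. \<phi> (of_coords (x(i := t))) \<partial>unif01) \<partial>PiM Basis (\<lambda>_. unif01))
    = (\<integral>\<^sup>+x\<in>cbox 0 One. \<phi> x \<partial>lborel)"
  unfolding nn_integral_unit_cube[OF assms(1)]
  using i emeasure_unif01
  by (intro unif01.nn_integral_PiM_average_coordinate borel_measurable_coordinate_average) auto

text \<open>Moving coordinate i through the unit interval traces the segment of the cube through the
  given point in direction i. The point has to lie in the cube, so that its own coordinate is among
  the parameters.\<close>

lemma abs_le_coordinate_average:
  fixes h :: "'a::euclidean_space \<Rightarrow> real"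
  assumes h: "\<And>x. GDERIV h x :> g x" and g: "continuous_on UNIV g"
    and x: "of_coords x \<in> cbox 0 (One :: 'a)" and i: "i \<in> Basis"
  shows "ennreal \<bar>h (of_coords x)\<bar>
    \<le> (\<integral>\<^sup>+t. ennreal (\<bar>h (of_coords (x(i := t)))\<bar> + norm (g (of_coords (x(i := t))))) \<partial>unif01)"
proof -
  have [measurable]: "h \<in> borel_measurable borel" "g \<in> borel_measurable borel"
    using GDERIV_continuous_on[OF h] g by (auto intro!: borel_measurable_continuous_onI)
  define z where "z = of_coords (x(i := 0))"
  have upd: "of_coords (x(i := t)) = z + t *\<^sub>R i" for t
    unfolding z_def by (rule of_coords_upd[OF i])
  have xi: "x i \<in> {0..1}" using x i by (auto simp: mem_box of_coords_inner)
  have xz: "of_coords x = z + x i *\<^sub>R i"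
    using upd[of "x i"] by simp
  have "ennreal \<bar>h (of_coords x)\<bar>
    \<le> (\<integral>\<^sup>+t\<in>{0..1}. ennreal (\<bar>h (z + t *\<^sub>R i)\<bar> + norm (g (z + t *\<^sub>R i))) \<partial>lborel)"
    unfolding xz by (rule ennreal_abs_le_unit_line_integral[OF h g xi norm_Basis[OF i]])
  also have "\<dots> = (\<integral>\<^sup>+t. ennreal (\<bar>h (of_coords (x(i := t)))\<bar> + norm (g (of_coords (x(i := t))))) \<partial>unif01)"
    unfolding upd by (subst nn_integral_density) (auto simp: mult.commute)
  finally show ?thesis .
qed

text \<open>Gagliardo's argument. The power p of |h| is a product of n equal factors, one for each
  coordinate; the i-th is bounded by the average \<open>\<psi> i\<close>, which does not depend on
  coordinate i. The condition \<open>p * (n - 1) \<le> n\<close>, with n the dimension, is the one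
  for Loomis-Whitney with exponent \<open>p / n\<close>.\<close>

theorem unit_cube_Sobolev:
  fixes h :: "'a::euclidean_space \<Rightarrow> real"
  assumes h: "\<And>x. GDERIV h x :> g x" and g: "continuous_on UNIV g"
    and p: "0 \<le> p" "p * (real DIM('a) - 1) \<le> real DIM('a)"
  shows "(\<integral>\<^sup>+x\<in>cbox 0 One. ennreal (\<bar>h x\<bar> powr p) \<partial>lborel)
    \<le> epowr (\<integral>\<^sup>+x\<in>cbox 0 One. ennreal (\<bar>h x\<bar> + norm (g x)) \<partial>lborel) p"
proof -
  have [measurable]: "h \<in> borel_measurable borel" "g \<in> borel_measurable borel"
    using GDERIV_continuous_on[OF h] g by (auto intro!: borel_measurable_continuous_onI)
  let ?P = "PiM (Basis :: 'a set) (\<lambda>_. unif01)" and ?n = "real DIM('a)"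
  define \<phi> where "\<phi> x = ennreal (\<bar>h x\<bar> + norm (g x))" for x
  have [measurable]: "\<phi> \<in> borel_measurable borel" unfolding \<phi>_def by measurable
  define \<psi> where "\<psi> i x = (\<integral>\<^sup>+t. \<phi> (of_coords (x(i := t))) \<partial>unif01)" for i and x :: "'a \<Rightarrow> real"
  \<comment> \<open>The indicator is inserted a second time: the product measure does not confine
    points to the cube, and the pointwise bound holds only there.\<close>
  have "(\<integral>\<^sup>+x\<in>cbox 0 One. ennreal (\<bar>h x\<bar> powr p) \<partial>lborel)
      = (\<integral>\<^sup>+x\<in>cbox 0 One. (ennreal (\<bar>h x\<bar> powr p) * indicator (cbox 0 One) x) \<partial>lborel)"
    by (intro nn_integral_cong) (auto simp: indicator_def)
  also have "\<dots> = (\<integral>\<^sup>+x. ennreal (\<bar>h (of_coords x)\<bar> powr p) * indicator (cbox 0 One) (of_coords x :: 'a) \<partial>?P)"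
    by (rule nn_integral_unit_cube) measurable
  also have "\<dots> \<le> (\<integral>\<^sup>+x. (\<Prod>i\<in>Basis. epowr (\<psi> i x) (p / ?n)) \<partial>?P)"
  proof (intro nn_integral_mono)
    fix x :: "'a \<Rightarrow> real"
    show "ennreal (\<bar>h (of_coords x)\<bar> powr p) * indicator (cbox 0 One) (of_coords x :: 'a)
      \<le> (\<Prod>i\<in>Basis. epowr (\<psi> i x) (p / ?n))"
    proof (cases "of_coords x \<in> cbox 0 (One :: 'a)")
      case True
      have "ennreal (\<bar>h (of_coords x)\<bar> powr p) = (\<Prod>i\<in>(Basis::'a set). epowr (ennreal \<bar>h (of_coords x)\<bar>) (p / ?n))"
        by (simp add: epowr_power epowr_ennreal[symmetric])
      also have "\<dots> \<le> (\<Prod>i\<in>Basis. epowr (\<psi> i x) (p / ?n))"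
        using p abs_le_coordinate_average[OF h g True]
        by (intro prod_mono_ennreal epowr_mono) (auto simp: \<psi>_def \<phi>_def)
      finally show ?thesis using True by simp
    qed simp
  qed
  also have "\<dots> \<le> (\<Prod>i\<in>Basis. epowr (\<integral>\<^sup>+x. \<psi> i x \<partial>?P) (p / ?n))"
    using p emeasure_unif01
    by (intro unif01.Loomis_Whitney_prob) (auto simp: \<psi>_def field_simps)
  also have "\<dots> = epowr (\<integral>\<^sup>+x\<in>cbox 0 One. \<phi> x \<partial>lborel) p"
    by (simp add: \<psi>_def nn_integral_coordinate_average epowr_power)
  finally show ?thesis unfolding \<phi>_def .
qed

text \<open>In dimension one the average over the only coordinate is a constant, so h is bounded
  uniformly. This is the infinite Sobolev exponent, which occurs below as
  \<open>w = 0\<close>.\<close>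

lemma unit_interval_Sobolev:
  fixes h :: "'a::euclidean_space \<Rightarrow> real"
  assumes h: "\<And>x. GDERIV h x :> g x" and g: "continuous_on UNIV g"
    and dim: "DIM('a) = 1" and y: "y \<in> cbox 0 One"
  shows "ennreal \<bar>h y\<bar> \<le> (\<integral>\<^sup>+x\<in>cbox 0 One. ennreal (\<bar>h x\<bar> + norm (g x)) \<partial>lborel)"
proof -
  have [measurable]: "h \<in> borel_measurable borel" "g \<in> borel_measurable borel"
    using GDERIV_continuous_on[OF h] g by (auto intro!: borel_measurable_continuous_onI)
  obtain i :: 'a where B: "Basis = {i}" using dim by (auto simp: card_1_singleton_iff)
  then have iB: "i \<in> Basis" by blast
  let ?P = "PiM (Basis :: 'a set) (\<lambda>_. unif01)"
  define \<phi> where "\<phi> x = ennreal (\<bar>h x\<bar> + norm (g x))" for x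
  have [measurable]: "\<phi> \<in> borel_measurable borel" unfolding \<phi>_def by measurable
  define \<psi> where "\<psi> x = (\<integral>\<^sup>+t. \<phi> (of_coords (x(i := t))) \<partial>unif01)" for x :: "'a \<Rightarrow> real"
  define x where "x b = y \<bullet> b" for b
  have xy: "of_coords x = y"
    by (simp add: of_coords_def x_def euclidean_representation)
  have const: "\<psi> z = \<psi> x" for z
    unfolding \<psi>_def of_coords_def B by simp
  have "ennreal \<bar>h y\<bar> \<le> \<psi> x"
    using abs_le_coordinate_average[OF h g, of x i] xy y iB by (simp add: \<psi>_def \<phi>_def)
  also have "\<psi> x = (\<integral>\<^sup>+z. \<psi> x \<partial>?P)"
    using unif01.emeasure_space_PiM_eq_1[of "Basis :: 'a set"] emeasure_unif01 by simp
  also have "\<dots> = (\<integral>\<^sup>+z. \<psi> z \<partial>?P)"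
    by (intro nn_integral_cong const[symmetric])
  also have "\<dots> = (\<integral>\<^sup>+x\<in>cbox 0 One. \<phi> x \<partial>lborel)"
    unfolding \<psi>_def using iB by (intro nn_integral_coordinate_average) auto
  finally show ?thesis unfolding \<phi>_def .
qed

text \<open>Hoelder's inequality between the powers \<open>p = 1 / w\<close> and u, with weights
  \<open>\<theta> * q * w\<close> and \<open>(1 - \<theta>) * q / u\<close>, whose sum is 1 by the
  relation for \<open>1 / q\<close>. The Sobolev inequality bounds the first integral; for
  \<open>w = 0\<close> the dimension is one and the uniform bound takes its place.\<close>

theorem unit_cube_Gagliardo_Nirenberg:
  fixes h :: "'a::euclidean_space \<Rightarrow> real"
  assumes h: "\<And>x. GDERIV h x :> g x" and g: "continuous_on UNIV g"
    and pos: "q > 0" "u > 0" and \<theta>: "0 \<le> \<theta>" "\<theta> \<le> 1"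
    and w: "0 \<le> w" "real DIM('a) - 1 \<le> real DIM('a) * w" and q: "1 / q = \<theta> * w + (1 - \<theta>) / u"
  shows "(\<integral>\<^sup>+x\<in>cbox 0 One. ennreal (\<bar>h x\<bar> powr q) \<partial>lborel)
    \<le> epowr (\<integral>\<^sup>+x\<in>cbox 0 One. ennreal (\<bar>h x\<bar> + norm (g x)) \<partial>lborel) (\<theta> * q)
      * epowr (\<integral>\<^sup>+x\<in>cbox 0 One. ennreal (\<bar>h x\<bar> powr u) \<partial>lborel) ((1 - \<theta>) * q / u)"
proof -
  have [measurable]: "h \<in> borel_measurable borel" "g \<in> borel_measurable borel"
    using GDERIV_continuous_on[OF h] g by (auto intro!: borel_measurable_continuous_onI)
  let ?Q = "cbox 0 One :: 'a set"
  define S where "S = (\<integral>\<^sup>+x\<in>?Q. ennreal (\<bar>h x\<bar> + norm (g x)) \<partial>lborel)"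
  define a b where "a = \<theta> * q * w" and "b = (1 - \<theta>) * q / u"
  have "a + b = q * (1 / q)" unfolding a_def b_def q by (simp add: algebra_simps)
  then have ab: "0 \<le> a" "0 \<le> b" "a + b = 1"
    using pos \<theta> w by (auto simp: a_def b_def)
  show ?thesis
  proof (cases "w = 0")
    case True
    then have dim: "DIM('a) = 1"
      using w(2) by (metis DIM_positive One_nat_def Suc_leI diff_le_0_iff_le le_antisym mult_zero_right of_nat_1 of_nat_le_iff)
    \<comment> \<open>With \<open>a = 0\<close> the whole Hoelder weight lies on u. Then
      \<open>q = \<theta> * q + u\<close>, and the first part of the power is bounded uniformly and
      pulled out of the integral.\<close>
    have b1: "b = 1" using ab True by (simp add: a_def)
    then have u: "(1 - \<theta>) * q = u" using pos by (auto simp: b_def field_simps)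
    have "(\<integral>\<^sup>+x\<in>?Q. ennreal (\<bar>h x\<bar> powr q) \<partial>lborel)
        \<le> (\<integral>\<^sup>+x. epowr S (\<theta> * q) * (ennreal (\<bar>h x\<bar> powr u) * indicator ?Q x) \<partial>lborel)"
    proof (intro nn_integral_mono)
      fix x :: 'a
      show "ennreal (\<bar>h x\<bar> powr q) * indicator ?Q x \<le> epowr S (\<theta> * q) * (ennreal (\<bar>h x\<bar> powr u) * indicator ?Q x)"
      proof (cases "x \<in> ?Q")
        case True
        have "ennreal (\<bar>h x\<bar> powr q) = epowr (ennreal \<bar>h x\<bar>) (\<theta> * q + u)"
          by (simp add: epowr_ennreal u[symmetric] algebra_simps)
        also have "\<dots> = epowr (ennreal \<bar>h x\<bar>) (\<theta> * q) * ennreal (\<bar>h x\<bar> powr u)"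
          by (simp add: epowr_add epowr_ennreal)
        also have "\<dots> \<le> epowr S (\<theta> * q) * ennreal (\<bar>h x\<bar> powr u)"
          using unit_interval_Sobolev[OF h g dim True] pos \<theta>
          by (intro mult_right_mono epowr_mono) (auto simp: S_def)
        finally show ?thesis using True by simp
      qed simp
    qed
    also have "\<dots> = epowr S (\<theta> * q) * (\<integral>\<^sup>+x\<in>?Q. ennreal (\<bar>h x\<bar> powr u) \<partial>lborel)"
      by (rule nn_integral_cmult) measurable
    finally show ?thesis unfolding S_def b_def[symmetric] b1 epowr_1 .
  next
    case False
    define p where "p = 1 / w"
    have p: "0 \<le> p" "p * (real DIM('a) - 1) \<le> real DIM('a)"
      using w False by (auto simp: p_def field_simps)
    have pa: "p * a = \<theta> * q" "u * b = (1 - \<theta>) * q"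
      using False pos by (auto simp: p_def a_def b_def)
    have "(\<integral>\<^sup>+x\<in>?Q. ennreal (\<bar>h x\<bar> powr q) \<partial>lborel)
        = (\<integral>\<^sup>+x. epowr (ennreal (\<bar>h x\<bar> powr p) * indicator ?Q x) a
              * epowr (ennreal (\<bar>h x\<bar> powr u) * indicator ?Q x) b \<partial>lborel)"
    proof (intro nn_integral_cong)
      fix x :: 'a
      have *: "\<theta> * q + (1 - \<theta>) * q = q" by (simp add: algebra_simps)
      show "ennreal (\<bar>h x\<bar> powr q) * indicator ?Q x
        = epowr (ennreal (\<bar>h x\<bar> powr p) * indicator ?Q x) a * epowr (ennreal (\<bar>h x\<bar> powr u) * indicator ?Q x) b"
        by (auto simp: indicator_def epowr_ennreal powr_powr pa ennreal_mult[symmetric] powr_add[symmetric] *)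
    qed
    also have "\<dots> \<le> epowr (\<integral>\<^sup>+x\<in>?Q. ennreal (\<bar>h x\<bar> powr p) \<partial>lborel) a
        * epowr (\<integral>\<^sup>+x\<in>?Q. ennreal (\<bar>h x\<bar> powr u) \<partial>lborel) b"
      using ab by (intro nn_integral_Holder2) auto
    also have "\<dots> \<le> epowr (epowr S p) a * epowr (\<integral>\<^sup>+x\<in>?Q. ennreal (\<bar>h x\<bar> powr u) \<partial>lborel) b"
      using ab unit_cube_Sobolev[OF h g p] by (intro mult_right_mono epowr_mono) (auto simp: S_def)
    finally show ?thesis by (simp add: epowr_epowr pa S_def b_def)
  qed
qed

section \<open>Affine changes of variables\<close>

lemma nn_integral_lborel_affine:
  fixes \<phi> :: "'a::euclidean_space \<Rightarrow> ennreal"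
  assumes [measurable]: "\<phi> \<in> borel_measurable borel" and c: "c \<noteq> 0"
  shows "(\<integral>\<^sup>+x. \<phi> x \<partial>lborel) = ennreal (\<bar>c\<bar> ^ DIM('a)) * (\<integral>\<^sup>+x. \<phi> (t + c *\<^sub>R x) \<partial>lborel)"
  by (subst lborel_affine[OF c, of t])
     (simp add: nn_integral_density nn_integral_distr nn_integral_cmult)

lemma GDERIV_affine:
  fixes h :: "'a::euclidean_space \<Rightarrow> real"
  assumes "\<And>x. GDERIV h x :> g x"
  shows "GDERIV (\<lambda>x. h (t + c *\<^sub>R x)) x :> c *\<^sub>R g (t + c *\<^sub>R x)"
proof -
  have "((\<lambda>x. h (t + c *\<^sub>R x)) has_derivative (\<lambda>y. (c *\<^sub>R y) \<bullet> g (t + c *\<^sub>R x))) (at x)"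
    by (rule has_derivative_compose[where g = h])
       (use assms[of "t + c *\<^sub>R x"] in \<open>auto simp: gderiv_def intro!: derivative_eq_intros\<close>)
  then show ?thesis by (simp add: gderiv_def)
qed

section \<open>The local Gagliardo-Nirenberg inequality\<close>

lemma continuous_on_affine:
  assumes "continuous_on UNIV (g :: 'a::real_normed_vector \<Rightarrow> 'b::real_normed_vector)"
  shows "continuous_on UNIV (\<lambda>x. c *\<^sub>R g (t + c *\<^sub>R x))"
  by (intro continuous_intros continuous_on_compose2[OF assms]) auto

text \<open>Rescaling to the unit cube. Of the constant only finiteness for fixed l matters; the
  factor l gained by the gradient is dropped because \<open>l \<le> 1\<close>.\<close>

lemma cube_Gagliardo_Nirenberg:
  fixes h :: "'a::euclidean_space \<Rightarrow> real"
  assumes h: "\<And>x. GDERIV h x :> g x" and g: "continuous_on UNIV g"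
    and pos: "q > 0" "u > 0" and \<theta>: "0 \<le> \<theta>" "\<theta> \<le> 1"
    and w: "0 \<le> w" "real DIM('a) - 1 \<le> real DIM('a) * w" and q: "1 / q = \<theta> * w + (1 - \<theta>) / u"
    and l: "0 < l" "l \<le> 1"
  shows "(\<integral>\<^sup>+x\<in>cbox a (a + l *\<^sub>R One). ennreal (\<bar>h x\<bar> powr q) \<partial>lborel)
    \<le> ennreal (l ^ DIM('a) * inverse (l ^ DIM('a)) powr (\<theta> * q) * inverse (l ^ DIM('a)) powr ((1 - \<theta>) * q / u))
      * (epowr (\<integral>\<^sup>+x\<in>cbox a (a + l *\<^sub>R One). ennreal (\<bar>h x\<bar> + norm (g x)) \<partial>lborel) (\<theta> * q)
        * epowr (\<integral>\<^sup>+x\<in>cbox a (a + l *\<^sub>R One). ennreal (\<bar>h x\<bar> powr u) \<partial>lborel) ((1 - \<theta>) * q / u))"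
proof -
  have [measurable]: "h \<in> borel_measurable borel" "g \<in> borel_measurable borel"
    using GDERIV_continuous_on[OF h] g by (auto intro!: borel_measurable_continuous_onI)
  let ?Q = "cbox a (a + l *\<^sub>R One)" and ?H = "\<lambda>x. h (a + l *\<^sub>R x)" and ?G = "\<lambda>x. l *\<^sub>R g (a + l *\<^sub>R x)"
  define d where "d = l ^ DIM('a)"
  have d: "d > 0" using l by (simp add: d_def)
  have sub: "(\<integral>\<^sup>+x\<in>?Q. \<phi> x \<partial>lborel) = ennreal d * (\<integral>\<^sup>+x\<in>cbox 0 One. \<phi> (a + l *\<^sub>R x) \<partial>lborel)"
    if [measurable]: "\<phi> \<in> borel_measurable borel" for \<phi> :: "'a \<Rightarrow> ennreal"
  proof -
    have "a + l *\<^sub>R x \<in> ?Q \<longleftrightarrow> x \<in> cbox 0 One" for x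
      using l by (auto simp: mem_box inner_add_left zero_le_mult_iff)
    then have "indicator ?Q (a + l *\<^sub>R x) = (indicator (cbox 0 One) x :: ennreal)" for x
      by (simp add: indicator_def)
    then show ?thesis
      using l by (subst nn_integral_lborel_affine[of _ l a]) (auto simp: d_def)
  qed
  have sub': "(\<integral>\<^sup>+x\<in>cbox 0 One. \<phi> (a + l *\<^sub>R x) \<partial>lborel) = ennreal (inverse d) * (\<integral>\<^sup>+x\<in>?Q. \<phi> x \<partial>lborel)"
    if "\<phi> \<in> borel_measurable borel" for \<phi> :: "'a \<Rightarrow> ennreal"
    using d unfolding sub[OF that] by (simp add: mult.assoc[symmetric] ennreal_mult[symmetric])
  have S: "(\<integral>\<^sup>+x\<in>cbox 0 One. ennreal (\<bar>?H x\<bar> + norm (?G x)) \<partial>lborel)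
      \<le> ennreal (inverse d) * (\<integral>\<^sup>+x\<in>?Q. ennreal (\<bar>h x\<bar> + norm (g x)) \<partial>lborel)"
  proof -
    have "norm (?G x) \<le> norm (g (a + l *\<^sub>R x))" for x
      using l mult_right_mono[of l 1 "norm (g (a + l *\<^sub>R x))"] by simp
    then have "(\<integral>\<^sup>+x\<in>cbox 0 One. ennreal (\<bar>?H x\<bar> + norm (?G x)) \<partial>lborel)
        \<le> (\<integral>\<^sup>+x\<in>cbox 0 One. ennreal (\<bar>h (a + l *\<^sub>R x)\<bar> + norm (g (a + l *\<^sub>R x))) \<partial>lborel)"
      by (intro nn_integral_mono mult_right_mono ennreal_leI add_left_mono) auto
    also have "\<dots> = ennreal (inverse d) * (\<integral>\<^sup>+x\<in>?Q. ennreal (\<bar>h x\<bar> + norm (g x)) \<partial>lborel)"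
      by (rule sub') measurable
    finally show ?thesis .
  qed
  have U: "(\<integral>\<^sup>+x\<in>cbox 0 One. ennreal (\<bar>?H x\<bar> powr u) \<partial>lborel)
      = ennreal (inverse d) * (\<integral>\<^sup>+x\<in>?Q. ennreal (\<bar>h x\<bar> powr u) \<partial>lborel)"
    by (rule sub') measurable
  have "(\<integral>\<^sup>+x\<in>?Q. ennreal (\<bar>h x\<bar> powr q) \<partial>lborel)
      = ennreal d * (\<integral>\<^sup>+x\<in>cbox 0 One. ennreal (\<bar>?H x\<bar> powr q) \<partial>lborel)"
    by (rule sub) measurable
  also have "\<dots> \<le> ennreal d * (epowr (\<integral>\<^sup>+x\<in>cbox 0 One. ennreal (\<bar>?H x\<bar> + norm (?G x)) \<partial>lborel) (\<theta> * q)
      * epowr (\<integral>\<^sup>+x\<in>cbox 0 One. ennreal (\<bar>?H x\<bar> powr u) \<partial>lborel) ((1 - \<theta>) * q / u))"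
    by (intro mult_left_mono unit_cube_Gagliardo_Nirenberg[OF GDERIV_affine[OF h] continuous_on_affine[OF g] pos \<theta> w q]) simp
  also have "\<dots> \<le> ennreal d * (epowr (ennreal (inverse d) * (\<integral>\<^sup>+x\<in>?Q. ennreal (\<bar>h x\<bar> + norm (g x)) \<partial>lborel)) (\<theta> * q)
      * epowr (ennreal (inverse d) * (\<integral>\<^sup>+x\<in>?Q. ennreal (\<bar>h x\<bar> powr u) \<partial>lborel)) ((1 - \<theta>) * q / u))"
    unfolding U using pos \<theta> by (intro mult_left_mono mult_right_mono epowr_mono S) auto
  also have "\<dots> = ennreal (d * inverse d powr (\<theta> * q) * inverse d powr ((1 - \<theta>) * q / u))
      * (epowr (\<integral>\<^sup>+x\<in>?Q. ennreal (\<bar>h x\<bar> + norm (g x)) \<partial>lborel) (\<theta> * q)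
      * epowr (\<integral>\<^sup>+x\<in>?Q. ennreal (\<bar>h x\<bar> powr u) \<partial>lborel) ((1 - \<theta>) * q / u))"
    using d by (simp add: epowr_mult epowr_ennreal ennreal_mult mult_ac)
  finally show ?thesis unfolding d_def .
qed

text \<open>Finitely many small cubes inside \<open>W\<close> cover the compact set
  \<open>Z\<close>. Each contributes the same bound, and their number becomes part of the
  constant.\<close>

theorem local_Gagliardo_Nirenberg:
  fixes Z W :: "'a::euclidean_space set"
  assumes Z: "compact Z" and W: "open W" "Z \<subseteq> W"
    and pos: "q > 0" "u > 0" and \<theta>: "0 \<le> \<theta>" "\<theta> \<le> 1"
    and w: "0 \<le> w" "real DIM('a) - 1 \<le> real DIM('a) * w" and q: "1 / q = \<theta> * w + (1 - \<theta>) / u"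
  obtains C where "C \<ge> 0" "\<And>h g. (\<And>x. GDERIV h x :> g x) \<Longrightarrow> continuous_on UNIV g \<Longrightarrow>
    (\<integral>\<^sup>+x\<in>Z. ennreal (\<bar>h x\<bar> powr q) \<partial>lborel)
    \<le> ennreal C * (epowr (\<integral>\<^sup>+x\<in>W. ennreal (\<bar>h x\<bar> + norm (g x)) \<partial>lborel) (\<theta> * q)
      * epowr (\<integral>\<^sup>+x\<in>W. ennreal (\<bar>h x\<bar> powr u) \<partial>lborel) ((1 - \<theta>) * q / u))"
proof -
  obtain e where e: "e > 0" "(\<Union>x\<in>Z. ball x e) \<subseteq> W"
    using compact_subset_open_imp_ball_epsilon_subset[OF Z W] by auto
  \<comment> \<open>A cube of side l centred at x lies within distance
    \<open>DIM('a) * l / 2\<close> of x, hence inside the ball of radius e.\<close>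
  define l where "l = min 1 (e / real DIM('a))"
  have l: "0 < l" "l \<le> 1" "real DIM('a) * l \<le> e"
    using e by (auto simp: l_def min_def field_simps)
  \<comment> \<open>The closed cubes carry the inequality; their interiors \<open>B x\<close> serve
    the compactness argument.\<close>
  define Q where "Q x = cbox (x - (l/2) *\<^sub>R One) ((x - (l/2) *\<^sub>R One) + l *\<^sub>R One)" for x :: 'a
  define B where "B x = box (x - (l/2) *\<^sub>R One) (x + (l/2) *\<^sub>R One)" for x :: 'a
  have BQ: "B x \<subseteq> Q x" for x
    unfolding B_def Q_def by (force simp: mem_box inner_diff_left inner_add_left)
  have QW: "Q x \<subseteq> W" if "x \<in> Z" for x
  proof
    fix y assume y: "y \<in> Q x"
    have "norm (y - x) \<le> (\<Sum>b\<in>Basis. \<bar>(y - x) \<bullet> b\<bar>)" by (rule norm_le_l1)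
    also have "\<dots> \<le> (\<Sum>b\<in>(Basis :: 'a set). l / 2)"
    proof (intro sum_mono)
      fix b :: 'a assume "b \<in> Basis"
      then have "x \<bullet> b - l / 2 \<le> y \<bullet> b \<and> y \<bullet> b \<le> x \<bullet> b + l / 2"
        using y by (auto simp: Q_def mem_box inner_diff_left inner_add_left)
      then show "\<bar>(y - x) \<bullet> b\<bar> \<le> l / 2"
        unfolding inner_diff_left by linarith
    qed
    also have "\<dots> < e" using l e(1) by simp
    finally have "y \<in> ball x e" by (simp add: dist_norm norm_minus_commute)
    then show "y \<in> W" using e(2) that by blast
  qed
  obtain D where D: "D \<subseteq> Z" "finite D" "Z \<subseteq> (\<Union>x\<in>D. B x)"
  proof (rule compactE_image[OF Z])
    show "open (B x)" if "x \<in> Z" for x unfolding B_def by (rule open_box)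
    show "Z \<subseteq> (\<Union>x\<in>Z. B x)"
      using l by (auto simp: B_def mem_box inner_diff_left inner_add_left)
  qed auto
  define K where "K = l ^ DIM('a) * inverse (l ^ DIM('a)) powr (\<theta> * q) * inverse (l ^ DIM('a)) powr ((1 - \<theta>) * q / u)"
  have K: "K \<ge> 0" using l by (auto simp: K_def)
  show ?thesis
  proof (rule that[of "real (card D) * K"])
    show "0 \<le> real (card D) * K" using K by simp
    fix h :: "'a \<Rightarrow> real" and g
    assume h: "\<And>x. GDERIV h x :> g x" and g: "continuous_on UNIV g"
    have [measurable]: "h \<in> borel_measurable borel" "g \<in> borel_measurable borel"
      using GDERIV_continuous_on[OF h] g by (auto intro!: borel_measurable_continuous_onI)
    let ?R = "epowr (\<integral>\<^sup>+x\<in>W. ennreal (\<bar>h x\<bar> + norm (g x)) \<partial>lborel) (\<theta> * q)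
      * epowr (\<integral>\<^sup>+x\<in>W. ennreal (\<bar>h x\<bar> powr u) \<partial>lborel) ((1 - \<theta>) * q / u)"
    have [measurable]: "Q x \<in> sets borel" for x unfolding Q_def by simp
    have "(\<integral>\<^sup>+x\<in>Z. ennreal (\<bar>h x\<bar> powr q) \<partial>lborel)
        \<le> (\<integral>\<^sup>+x. (\<Sum>z\<in>D. ennreal (\<bar>h x\<bar> powr q) * indicator (Q z) x) \<partial>lborel)"
    proof (intro nn_integral_mono)
      fix x
      show "ennreal (\<bar>h x\<bar> powr q) * indicator Z x \<le> (\<Sum>z\<in>D. ennreal (\<bar>h x\<bar> powr q) * indicator (Q z) x)"
      proof (cases "x \<in> Z")
        case True
        then obtain z where z: "z \<in> D" "x \<in> Q z" using D BQ by blast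
        then have "ennreal (\<bar>h x\<bar> powr q) * indicator Z x = ennreal (\<bar>h x\<bar> powr q) * indicator (Q z) x"
          using True by simp
        also have "\<dots> \<le> (\<Sum>z\<in>D. ennreal (\<bar>h x\<bar> powr q) * indicator (Q z) x)"
          using z D by (intro member_le_sum) auto
        finally show ?thesis .
      qed simp
    qed
    also have "\<dots> = (\<Sum>z\<in>D. (\<integral>\<^sup>+x\<in>Q z. ennreal (\<bar>h x\<bar> powr q) \<partial>lborel))"
      by (rule nn_integral_sum) measurable
    also have "\<dots> \<le> (\<Sum>z\<in>D. ennreal K * ?R)"
    proof (intro sum_mono)
      fix z assume "z \<in> D"
      then have QW': "Q z \<subseteq> W" using D QW by auto
      have mono: "(\<integral>\<^sup>+x\<in>Q z. \<phi> x \<partial>lborel) \<le> (\<integral>\<^sup>+x\<in>W. \<phi> x \<partial>lborel)" for \<phi> :: "'a \<Rightarrow> ennreal"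
        using QW' by (intro nn_integral_mono) (auto simp: indicator_def)
      have "(\<integral>\<^sup>+x\<in>Q z. ennreal (\<bar>h x\<bar> powr q) \<partial>lborel)
        \<le> ennreal K * (epowr (\<integral>\<^sup>+x\<in>Q z. ennreal (\<bar>h x\<bar> + norm (g x)) \<partial>lborel) (\<theta> * q)
          * epowr (\<integral>\<^sup>+x\<in>Q z. ennreal (\<bar>h x\<bar> powr u) \<partial>lborel) ((1 - \<theta>) * q / u))"
        unfolding Q_def K_def by (rule cube_Gagliardo_Nirenberg[OF h g pos \<theta> w q l(1,2)])
      also have "\<dots> \<le> ennreal K * ?R"
        using pos \<theta> by (intro mult_left_mono mult_mono epowr_mono mono) auto
      finally show "(\<integral>\<^sup>+x\<in>Q z. ennreal (\<bar>h x\<bar> powr q) \<partial>lborel) \<le> ennreal K * ?R" .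
    qed
    also have "\<dots> = ennreal (real (card D) * K) * ?R"
      using K by (simp add: ennreal_mult ennreal_of_nat_eq_real_of_nat mult.assoc)
    finally show "(\<integral>\<^sup>+x\<in>Z. ennreal (\<bar>h x\<bar> powr q) \<partial>lborel) \<le> ennreal (real (card D) * K) * ?R" .
  qed
qed

section \<open>Dyadic annuli\<close>

text \<open>With \<open>(1 + e) powr p = \<delta>\<close>, either \<open>b \<le> e * a\<close> and
  the sum is at most \<open>(1 + e) * a\<close>, or a is bounded by a multiple of b. All loss sits
  on b, so the coefficient of a can be as close to 1 as iteration requires.\<close>

lemma powr_add_le_powr_scaled:
  assumes "\<delta> > 1" "p > 0"
  obtains C :: real where "C \<ge> 0"
    "\<And>a b. a \<ge> 0 \<Longrightarrow> b \<ge> 0 \<Longrightarrow> (a + b) powr p \<le> \<delta> * a powr p + C * b powr p"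
proof -
  define e where "e = \<delta> powr (1/p) - 1"
  have "1 powr (1/p) < \<delta> powr (1/p)"
    using assms by (intro powr_less_mono2) auto
  then have e: "e > 0" by (simp add: e_def)
  have ep: "(1 + e) powr p = \<delta>" using assms by (simp add: e_def powr_powr)
  show ?thesis
  proof (rule that[of "(1/e + 1) powr p"])
    fix a b :: real assume ab: "a \<ge> 0" "b \<ge> 0"
    show "(a + b) powr p \<le> \<delta> * a powr p + (1/e + 1) powr p * b powr p"
    proof (cases "b \<le> e * a")
      case True
      then have "(a + b) powr p \<le> ((1 + e) * a) powr p"
        using assms ab by (intro powr_mono2) (auto simp: algebra_simps)
      also have "\<dots> = \<delta> * a powr p"
        using ab e by (simp add: powr_mult ep)
      finally show ?thesis by (simp add: add_increasing2)
    next
      case False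
      then have "(a + b) powr p \<le> ((1/e + 1) * b) powr p"
        using assms ab e by (intro powr_mono2) (auto simp: field_simps)
      also have "\<dots> = (1/e + 1) powr p * b powr p"
        using ab e by (simp add: powr_mult)
      finally show ?thesis using assms by (simp add: add_increasing)
    qed
  qed simp
qed

text \<open>The integral of \<phi> over the k-th annulus divided by 2^(k n), n the dimension,
  written on a fixed annulus so that dilating \<phi> shifts k. For continuous \<phi> the integral is
  finite and \<open>enn2real\<close> loses nothing.\<close>

definition dyadic_mean :: "('a::euclidean_space \<Rightarrow> real) \<Rightarrow> int \<Rightarrow> real" where
  "dyadic_mean \<phi> k = enn2real (\<integral>\<^sup>+x\<in>annulus 0. ennreal (\<phi> ((2 powr real_of_int k) *\<^sub>R x)) \<partial>lborel)"

lemma dyadic_mean_nonneg [simp]: "0 \<le> dyadic_mean \<phi> k"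
  by (simp add: dyadic_mean_def)

lemma dyadic_mean_dilate:
  "dyadic_mean (\<lambda>x. \<phi> ((2 powr real_of_int j) *\<^sub>R x)) k = dyadic_mean \<phi> (k + j)"
  by (simp add: dyadic_mean_def powr_add mult.commute)

lemma annulus_eq: "annulus k = {x. 2 powr (real_of_int k - 1) \<le> norm x} \<inter> {x. norm x < 2 powr real_of_int k}"
  by (auto simp: annulus_def)

lemma annulus_borel [measurable]: "annulus k \<in> sets borel"
  unfolding annulus_eq by measurable

lemma dyadic_mean_cmult:
  assumes "c \<ge> 0" and [measurable]: "\<phi> \<in> borel_measurable borel"
  shows "dyadic_mean (\<lambda>x. c * \<phi> x) k = c * dyadic_mean \<phi> k"
proof -
  let ?x = "\<lambda>x. (2 powr real_of_int k) *\<^sub>R x"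
  have "(\<integral>\<^sup>+x\<in>annulus 0. ennreal (c * \<phi> (?x x)) \<partial>lborel)
      = (\<integral>\<^sup>+x. ennreal c * (ennreal (\<phi> (?x x)) * indicator (annulus 0) x) \<partial>lborel)"
    using assms(1) by (intro nn_integral_cong) (simp add: ennreal_mult' mult.assoc)
  also have "\<dots> = ennreal c * (\<integral>\<^sup>+x\<in>annulus 0. ennreal (\<phi> (?x x)) \<partial>lborel)"
    by (rule nn_integral_cmult) measurable
  finally show ?thesis
    using assms(1) by (simp add: dyadic_mean_def enn2real_mult)
qed

lemma annulus_0: "annulus 0 = {x. 1/2 \<le> norm x \<and> norm x < 1}"
  by (simp add: annulus_def powr_minus_divide)

lemma ennreal_dyadic_mean:
  fixes \<phi> :: "'a::euclidean_space \<Rightarrow> real"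
  assumes \<phi>: "continuous_on UNIV \<phi>"
  shows "(\<integral>\<^sup>+x\<in>annulus 0. ennreal (\<phi> ((2 powr real_of_int k) *\<^sub>R x)) \<partial>lborel) = ennreal (dyadic_mean \<phi> k)"
proof -
  have [measurable]: "\<phi> \<in> borel_measurable borel"
    using \<phi> by (rule borel_measurable_continuous_onI)
  have "bounded ((\<lambda>x. \<phi> ((2 powr real_of_int k) *\<^sub>R x)) ` cball 0 1)"
    by (intro compact_imp_bounded compact_continuous_image continuous_on_compose2[OF \<phi>] continuous_intros) auto
  then obtain B where B: "\<And>x. norm x \<le> 1 \<Longrightarrow> \<bar>\<phi> ((2 powr real_of_int k) *\<^sub>R x)\<bar> \<le> B"
    by (force simp: bounded_iff)
  have "(\<integral>\<^sup>+x\<in>annulus 0. ennreal (\<phi> ((2 powr real_of_int k) *\<^sub>R x)) \<partial>lborel)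
      \<le> (\<integral>\<^sup>+x. ennreal B * indicator (cball 0 1 :: 'a set) x \<partial>lborel)"
    using B by (intro nn_integral_mono) (auto simp: annulus_0 indicator_def abs_le_iff intro!: ennreal_leI)
  also have "\<dots> = ennreal B * emeasure lborel (cball 0 1 :: 'a set)"
    by (intro nn_integral_cmult_indicator) simp
  also have "\<dots> < top"
    using emeasure_bounded_finite[of "cball 0 1 :: 'a set"] by (simp add: ennreal_mult_less_top)
  finally show ?thesis
    by (simp add: dyadic_mean_def less_top)
qed

lemma nn_integral_annulus:
  fixes \<phi> :: "'a::euclidean_space \<Rightarrow> real"
  assumes \<phi>: "continuous_on UNIV \<phi>"
  shows "(\<integral>\<^sup>+x\<in>annulus k. ennreal (\<phi> x) \<partial>lborel) = ennreal (2 powr (real_of_int k * DIM('a)) * dyadic_mean \<phi> k)"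
proof -
  have [measurable]: "\<phi> \<in> borel_measurable borel"
    using \<phi> by (rule borel_measurable_continuous_onI)
  let ?c = "2 powr real_of_int k"
  have "?c *\<^sub>R x \<in> annulus k \<longleftrightarrow> x \<in> annulus 0" for x :: 'a
    by (simp add: annulus_def powr_diff powr_minus_divide field_simps)
  then have ind: "indicator (annulus k) (?c *\<^sub>R x) = (indicator (annulus 0) x :: ennreal)" for x :: 'a
    by (simp add: indicator_def)
  have "(\<integral>\<^sup>+x\<in>annulus k. ennreal (\<phi> x) \<partial>lborel)
      = ennreal (\<bar>?c\<bar> ^ DIM('a)) * (\<integral>\<^sup>+x\<in>annulus 0. ennreal (\<phi> (?c *\<^sub>R x)) \<partial>lborel)"
    by (subst nn_integral_lborel_affine[of _ ?c 0]) (auto simp: ind)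
  also have "\<dots> = ennreal (2 powr (real_of_int k * DIM('a)) * dyadic_mean \<phi> k)"
    unfolding ennreal_dyadic_mean[OF \<phi>]
    by (simp add: ennreal_mult powr_realpow[symmetric] powr_powr)
  finally show ?thesis .
qed

text \<open>The offsets -1 to 2 cover \<open>1/4 \<le> norm x < 4\<close>. This contains the open
  neighbourhood \<open>1/4 < norm x < 2\<close> of the closure of \<open>annulus 0\<close> as well
  as its image under doubling.\<close>

definition window_sum :: "(int \<Rightarrow> real) \<Rightarrow> int \<Rightarrow> real" where
  "window_sum a k = (\<Sum>j\<in>{-1..2}. a (k + j))"

lemma window_eq_annuli:
  "{x::'a::euclidean_space. 1/4 \<le> norm x \<and> norm x < 4} = (\<Union>j\<in>{-1..2}. annulus j)"
proof -
  have "{-1..2::int} = {-1,0,1,2}" by auto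
  then show ?thesis by (auto simp: annulus_def powr_minus_divide)
qed

lemma nn_integral_window_le:
  fixes \<phi> :: "'a::euclidean_space \<Rightarrow> real"
  assumes \<phi>: "continuous_on UNIV \<phi>"
  shows "(\<integral>\<^sup>+x\<in>{x. 1/4 \<le> norm x \<and> norm x < 4}. ennreal (\<phi> x) \<partial>lborel)
    \<le> ennreal (4 ^ DIM('a) * window_sum (dyadic_mean \<phi>) 0)"
proof -
  have [measurable]: "\<phi> \<in> borel_measurable borel"
    using \<phi> by (rule borel_measurable_continuous_onI)
  have "(\<integral>\<^sup>+x\<in>{x. 1/4 \<le> norm x \<and> norm x < 4}. ennreal (\<phi> x) \<partial>lborel)
      \<le> (\<integral>\<^sup>+x. (\<Sum>j\<in>{-1..2}. ennreal (\<phi> x) * indicator (annulus j) x) \<partial>lborel)"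
    unfolding window_eq_annuli
  proof (intro nn_integral_mono)
    fix x :: 'a
    show "ennreal (\<phi> x) * indicator (\<Union>j\<in>{-1..2}. annulus j) x \<le> (\<Sum>j\<in>{-1..2}. ennreal (\<phi> x) * indicator (annulus j) x)"
    proof (cases "x \<in> (\<Union>j\<in>{-1..2}. annulus j)")
      case True
      then obtain j where j: "j \<in> {-1..2::int}" "x \<in> annulus j" by auto
      then have "ennreal (\<phi> x) * indicator (\<Union>j\<in>{-1..2}. annulus j) x = ennreal (\<phi> x) * indicator (annulus j) x"
        using True by simp
      also have "\<dots> \<le> (\<Sum>j\<in>{-1..2}. ennreal (\<phi> x) * indicator (annulus j) x)"
        using j by (intro member_le_sum) auto
      finally show ?thesis .
    qed simp
  qed
  also have "\<dots> = (\<Sum>j\<in>{-1..2::int}. (\<integral>\<^sup>+x\<in>annulus j. ennreal (\<phi> x) \<partial>lborel))"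
    by (rule nn_integral_sum) measurable
  also have "\<dots> = (\<Sum>j\<in>{-1..2::int}. ennreal (2 powr (real_of_int j * DIM('a)) * dyadic_mean \<phi> j))"
    by (simp add: nn_integral_annulus[OF \<phi>])
  also have "\<dots> \<le> (\<Sum>j\<in>{-1..2::int}. ennreal (4 ^ DIM('a) * dyadic_mean \<phi> j))"
  proof (intro sum_mono ennreal_leI mult_right_mono)
    fix j :: int assume j: "j \<in> {-1..2}"
    have "2 powr (real_of_int j * DIM('a)) \<le> 2 powr (2 * DIM('a))"
      using j by (intro powr_mono mult_right_mono) auto
    also have "\<dots> = 4 ^ DIM('a)"
      by (simp add: powr_powr[symmetric] powr_realpow)
    finally show "2 powr (real_of_int j * DIM('a)) \<le> 4 ^ DIM('a)" .
  qed simp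
  also have "\<dots> = ennreal (4 ^ DIM('a) * window_sum (dyadic_mean \<phi>) 0)"
    by (subst sum_ennreal) (auto simp: window_sum_def sum_distrib_left)
  finally show ?thesis .
qed

text \<open>For these t the dilated region stays inside the larger window, and the Jacobian
  \<open>t ^ DIM('a)\<close> is at least 1, so it can be inserted for the change of
  variables.\<close>

lemma nn_integral_dilate_window_le:
  fixes \<phi> :: "'a::euclidean_space \<Rightarrow> ennreal"
  assumes [measurable]: "\<phi> \<in> borel_measurable borel" and t: "1 \<le> t" "t \<le> 2"
  shows "(\<integral>\<^sup>+x\<in>{x. 1/4 < norm x \<and> norm x < 2}. \<phi> (t *\<^sub>R x) \<partial>lborel)
    \<le> (\<integral>\<^sup>+x\<in>{x. 1/4 \<le> norm x \<and> norm x < 4}. \<phi> x \<partial>lborel)"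
proof -
  have "(\<integral>\<^sup>+x\<in>{x. 1/4 < norm x \<and> norm x < 2}. \<phi> (t *\<^sub>R x) \<partial>lborel)
      \<le> (\<integral>\<^sup>+x. \<phi> (t *\<^sub>R x) * indicator {x. 1/4 \<le> norm x \<and> norm x < 4} (t *\<^sub>R x) \<partial>lborel)"
  proof (intro nn_integral_mono mult_left_mono)
    fix x :: 'a
    have "t *\<^sub>R x \<in> {x. 1/4 \<le> norm x \<and> norm x < 4}" if "1/4 < norm x" "norm x < 2"
    proof -
      have "1 * norm x \<le> t * norm x" "t * norm x \<le> 2 * norm x"
        using t by (intro mult_right_mono; simp)+
      then show ?thesis using that t by auto
    qed
    then show "indicator {x. 1/4 < norm x \<and> norm x < 2} x \<le> (indicator {x. 1/4 \<le> norm x \<and> norm x < 4} (t *\<^sub>R x) :: ennreal)"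
      by (auto simp: indicator_def)
  qed simp
  also have "\<dots> = 1 * \<dots>" by simp
  also have "\<dots> \<le> ennreal (\<bar>t\<bar> ^ DIM('a)) * (\<integral>\<^sup>+x. \<phi> (t *\<^sub>R x) * indicator {x. 1/4 \<le> norm x \<and> norm x < 4} (t *\<^sub>R x) \<partial>lborel)"
    using t by (intro mult_right_mono) auto
  also have "\<dots> = (\<integral>\<^sup>+x\<in>{x. 1/4 \<le> norm x \<and> norm x < 4}. \<phi> x \<partial>lborel)"
    using t by (subst nn_integral_lborel_affine[of _ t 0]) auto
  finally show ?thesis .
qed

text \<open>Comparing a function with its dilate replaces a Poincare inequality on the annuli, which
  would fail in dimension one, where they are disconnected.\<close>

lemma nn_integral_dilate_diff_le:
  fixes f :: "'a::euclidean_space \<Rightarrow> real"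
  assumes f: "\<And>x. GDERIV f x :> g x" and g: "continuous_on UNIV g"
  shows "(\<integral>\<^sup>+x\<in>{x. 1/4 < norm x \<and> norm x < 2}. ennreal \<bar>f x - f (2 *\<^sub>R x)\<bar> \<partial>lborel)
    \<le> 2 * (\<integral>\<^sup>+x\<in>{x. 1/4 \<le> norm x \<and> norm x < 4}. ennreal (norm (g x)) \<partial>lborel)" (is "_ \<le> 2 * ?G")
proof -
  have [measurable]: "g \<in> borel_measurable borel" "f \<in> borel_measurable borel"
    using GDERIV_continuous_on[OF f] g by (auto intro!: borel_measurable_continuous_onI)
  let ?W = "{x::'a. 1/4 < norm x \<and> norm x < 2}"
  have "(\<integral>\<^sup>+x\<in>?W. ennreal \<bar>f x - f (2 *\<^sub>R x)\<bar> \<partial>lborel)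
      \<le> (\<integral>\<^sup>+x. (\<integral>\<^sup>+t. (2 * ennreal (norm (g (t *\<^sub>R x)))) * indicator ?W x * indicator {1..2::real} t \<partial>lborel) \<partial>lborel)"
  proof (intro nn_integral_mono)
    fix x :: 'a
    show "ennreal \<bar>f x - f (2 *\<^sub>R x)\<bar> * indicator ?W x
      \<le> (\<integral>\<^sup>+t. (2 * ennreal (norm (g (t *\<^sub>R x)))) * indicator ?W x * indicator {1..2::real} t \<partial>lborel)"
    proof (cases "x \<in> ?W")
      case True
      have "ennreal \<bar>f x - f (2 *\<^sub>R x)\<bar> \<le> (\<integral>\<^sup>+t\<in>{1..2}. ennreal (norm x * norm (g (t *\<^sub>R x))) \<partial>lborel)"
        using ennreal_abs_diff_le_line_integral[OF f g, of 1 1 2 2 0 x] by simp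
      also have "\<dots> \<le> (\<integral>\<^sup>+t\<in>{1..2}. (2 * ennreal (norm (g (t *\<^sub>R x)))) \<partial>lborel)"
      proof (intro nn_integral_mono mult_right_mono)
        fix t
        have "ennreal (norm x * norm (g (t *\<^sub>R x))) \<le> ennreal (2 * norm (g (t *\<^sub>R x)))"
          using True by (intro ennreal_leI mult_right_mono) auto
        then show "ennreal (norm x * norm (g (t *\<^sub>R x))) \<le> 2 * ennreal (norm (g (t *\<^sub>R x)))"
          by (simp add: ennreal_mult)
      qed simp
      finally show ?thesis using True by simp
    qed simp
  qed
  also have "\<dots> = (\<integral>\<^sup>+t. (\<integral>\<^sup>+x. (2 * ennreal (norm (g (t *\<^sub>R x)))) * indicator ?W x * indicator {1..2::real} t \<partial>lborel) \<partial>lborel)"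
    by (rule lborel_pair.Fubini') measurable
  also have "\<dots> = (\<integral>\<^sup>+t\<in>{1..2::real}. (\<integral>\<^sup>+x\<in>?W. (2 * ennreal (norm (g (t *\<^sub>R x)))) \<partial>lborel) \<partial>lborel)"
    by (intro nn_integral_cong nn_integral_multc) measurable
  also have "\<dots> \<le> (\<integral>\<^sup>+t\<in>{1..2::real}. (2 * ?G) \<partial>lborel)"
  proof (intro nn_integral_mono)
    fix t :: real
    have "(\<integral>\<^sup>+x\<in>?W. (2 * ennreal (norm (g (t *\<^sub>R x)))) \<partial>lborel) \<le> 2 * ?G" if "t \<in> {1..2}"
    proof -
      have "(\<integral>\<^sup>+x\<in>?W. (2 * ennreal (norm (g (t *\<^sub>R x)))) \<partial>lborel) = 2 * (\<integral>\<^sup>+x\<in>?W. ennreal (norm (g (t *\<^sub>R x))) \<partial>lborel)"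
        by (simp add: mult.assoc nn_integral_cmult)
      also have "\<dots> \<le> 2 * ?G"
        using that by (intro mult_left_mono nn_integral_dilate_window_le) auto
      finally show ?thesis .
    qed
    then show "(\<integral>\<^sup>+x\<in>?W. (2 * ennreal (norm (g (t *\<^sub>R x)))) \<partial>lborel) * indicator {1..2} t \<le> 2 * ?G * indicator {1..2} t"
      by (auto simp: indicator_def)
  qed
  also have "\<dots> = 2 * ?G"
    by (subst nn_integral_cmult_indicator) auto
  finally show ?thesis .
qed

section \<open>Estimates on one annulus for f and for its dilation difference\<close>

lemma continuous_on_abs_powr:
  fixes f :: "'a::topological_space \<Rightarrow> real"
  assumes "continuous_on S f" "p > 0"
  shows "continuous_on S (\<lambda>x. \<bar>f x\<bar> powr p)"
  using assms by (intro continuous_on_powr' continuous_intros) auto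

lemma GDERIV_dilate_diff:
  fixes f :: "'a::euclidean_space \<Rightarrow> real"
  assumes f: "\<And>x. GDERIV f x :> g x"
  shows "GDERIV (\<lambda>x. f x - f (2 *\<^sub>R x)) x :> g x - 2 *\<^sub>R g (2 *\<^sub>R x)"
  using GDERIV_diff[OF f GDERIV_affine[OF f, of 0 2]] by simp

lemma window_sum_nonneg: "(\<And>j. 0 \<le> a j) \<Longrightarrow> 0 \<le> window_sum a k"
  unfolding window_sum_def by (intro sum_nonneg) auto

text \<open>The annuli of the window have index \<open>j \<ge> -1\<close>, where
  \<open>2 powr j \<ge> 1/2\<close>; the factor 2 pays for inserting this weight.\<close>

lemma nn_integral_window_gradient_le:
  fixes g :: "'a::euclidean_space \<Rightarrow> 'a"
  assumes g: "continuous_on UNIV g"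
  shows "(\<integral>\<^sup>+x\<in>{x. 1/4 \<le> norm x \<and> norm x < 4}. ennreal (norm (g x)) \<partial>lborel)
    \<le> ennreal (4 ^ DIM('a) * 2 * window_sum (\<lambda>k. 2 powr real_of_int k * dyadic_mean (\<lambda>x. norm (g x)) k) 0)"
proof -
  have "window_sum (dyadic_mean (\<lambda>x. norm (g x))) 0
      \<le> 2 * window_sum (\<lambda>k. 2 powr real_of_int k * dyadic_mean (\<lambda>x. norm (g x)) k) 0"
    unfolding window_sum_def sum_distrib_left
  proof (intro sum_mono)
    fix j :: int assume "j \<in> {-1..2}"
    then have "2 powr 0 \<le> (2::real) powr (1 + real_of_int j)" by (intro powr_mono) auto
    then have "1 \<le> 2 * 2 powr real_of_int j" by (simp add: powr_add)
    then have "1 * dyadic_mean (\<lambda>x. norm (g x)) (0 + j)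
        \<le> (2 * 2 powr real_of_int (0 + j)) * dyadic_mean (\<lambda>x. norm (g x)) (0 + j)"
      by (intro mult_right_mono) auto
    then show "dyadic_mean (\<lambda>x. norm (g x)) (0 + j) \<le> 2 * (2 powr real_of_int (0 + j) * dyadic_mean (\<lambda>x. norm (g x)) (0 + j))"
      by (simp add: mult.assoc)
  qed
  then have "4 ^ DIM('a) * window_sum (dyadic_mean (\<lambda>x. norm (g x))) 0
      \<le> 4 ^ DIM('a) * 2 * window_sum (\<lambda>k. 2 powr real_of_int k * dyadic_mean (\<lambda>x. norm (g x)) k) 0"
    by simp
  then show ?thesis
    by (intro order_trans[OF nn_integral_window_le[OF continuous_on_norm[OF g]]] ennreal_leI)
qed

text \<open>The half-open annulus is enlarged to a closed shell, to which the local inequality for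
  compact sets applies.\<close>

lemma annulus_Gagliardo_Nirenberg:
  assumes pos: "q > 0" "u > 0" and \<theta>: "0 \<le> \<theta>" "\<theta> \<le> 1"
    and w: "0 \<le> w" "real DIM('a::euclidean_space) - 1 \<le> real DIM('a) * w" and q: "1 / q = \<theta> * w + (1 - \<theta>) / u"
  obtains C where "C \<ge> 0" "\<And>(h :: 'a \<Rightarrow> real) g. (\<And>x. GDERIV h x :> g x) \<Longrightarrow> continuous_on UNIV g \<Longrightarrow>
    (\<integral>\<^sup>+x\<in>annulus 0. ennreal (\<bar>h x\<bar> powr q) \<partial>lborel)
    \<le> ennreal C * (epowr (\<integral>\<^sup>+x\<in>{x. 1/4 < norm x \<and> norm x < 2}. ennreal (\<bar>h x\<bar> + norm (g x)) \<partial>lborel) (\<theta> * q)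
      * epowr (\<integral>\<^sup>+x\<in>{x. 1/4 < norm x \<and> norm x < 2}. ennreal (\<bar>h x\<bar> powr u) \<partial>lborel) ((1 - \<theta>) * q / u))"
proof -
  let ?Z = "cball 0 1 - ball 0 (1/2) :: 'a set" and ?W = "{x::'a. 1/4 < norm x \<and> norm x < 2}"
  have Z: "compact ?Z" by (intro compact_diff) auto
  have W: "open ?W"
    by (intro open_Collect_conj open_Collect_less continuous_intros)
  have ZW: "?Z \<subseteq> ?W" by auto
  have AZ: "annulus 0 \<subseteq> ?Z" by (auto simp: annulus_0)
  obtain C where C: "C \<ge> 0" "\<And>h g. (\<And>x. GDERIV h x :> g x) \<Longrightarrow> continuous_on UNIV g \<Longrightarrow>
    (\<integral>\<^sup>+x\<in>?Z. ennreal (\<bar>h x\<bar> powr q) \<partial>lborel)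
    \<le> ennreal C * (epowr (\<integral>\<^sup>+x\<in>?W. ennreal (\<bar>h x\<bar> + norm (g x)) \<partial>lborel) (\<theta> * q)
      * epowr (\<integral>\<^sup>+x\<in>?W. ennreal (\<bar>h x\<bar> powr u) \<partial>lborel) ((1 - \<theta>) * q / u))"
    using local_Gagliardo_Nirenberg[OF Z W ZW pos \<theta> w q] by blast
  have sub: "(\<integral>\<^sup>+x\<in>annulus 0. \<phi> x \<partial>lborel) \<le> (\<integral>\<^sup>+x\<in>?Z. \<phi> x \<partial>lborel)" for \<phi> :: "'a \<Rightarrow> ennreal"
    using AZ by (intro nn_integral_mono) (auto simp: indicator_def)
  show ?thesis
  proof (rule that[OF C(1)], goal_cases)
    case (1 h g)
    then show ?case by (intro order_trans[OF sub C(2)])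
  qed
qed

text \<open>For h(x) = f(x) - f(2x) the L1 norm of h in the local inequality is itself controlled by
  the gradient of f. Hence the first factor on the right contains the gradient alone.\<close>

lemma dilate_diff_interpolation:
  assumes pos: "q > 0" "u > 0" and \<theta>: "0 \<le> \<theta>" "\<theta> \<le> 1"
    and w: "0 \<le> w" "real DIM('a::euclidean_space) - 1 \<le> real DIM('a) * w" and q: "1 / q = \<theta> * w + (1 - \<theta>) / u"
  obtains C where "C \<ge> 0" "\<And>(f :: 'a \<Rightarrow> real) g. (\<And>x. GDERIV f x :> g x) \<Longrightarrow> continuous_on UNIV g \<Longrightarrow>
    (\<integral>\<^sup>+x\<in>annulus 0. ennreal (\<bar>f x - f (2 *\<^sub>R x)\<bar> powr q) \<partial>lborel)
    \<le> ennreal (C * (window_sum (\<lambda>k. 2 powr real_of_int k * dyadic_mean (\<lambda>x. norm (g x)) k) 0 powr (\<theta> * q)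
      * window_sum (dyadic_mean (\<lambda>x. \<bar>f x\<bar> powr u)) 0 powr ((1 - \<theta>) * q / u)))"
proof -
  let ?W = "{x::'a. 1/4 < norm x \<and> norm x < 2}" and ?W' = "{x::'a. 1/4 \<le> norm x \<and> norm x < 4}"
  obtain C where C: "C \<ge> 0" "\<And>(h :: 'a \<Rightarrow> real) g. (\<And>x. GDERIV h x :> g x) \<Longrightarrow> continuous_on UNIV g \<Longrightarrow>
    (\<integral>\<^sup>+x\<in>annulus 0. ennreal (\<bar>h x\<bar> powr q) \<partial>lborel)
    \<le> ennreal C * (epowr (\<integral>\<^sup>+x\<in>?W. ennreal (\<bar>h x\<bar> + norm (g x)) \<partial>lborel) (\<theta> * q)
      * epowr (\<integral>\<^sup>+x\<in>?W. ennreal (\<bar>h x\<bar> powr u) \<partial>lborel) ((1 - \<theta>) * q / u))"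
    using annulus_Gagliardo_Nirenberg[OF pos \<theta> w q] by blast
  define a b where "a = \<theta> * q" and "b = (1 - \<theta>) * q / u"
  have ab: "a \<ge> 0" "b \<ge> 0" using pos \<theta> by (auto simp: a_def b_def)
  \<comment> \<open>5 = 2 + 1 + 2 collects the L1 norm of the difference, the gradient, and the
    dilated gradient with its chain rule factor; the rest of \<open>c1\<close> is the window bound.
    In \<open>c2\<close> the three factors come from the power u of a sum, from the two terms f(x)
    and f(2x), and from the window.\<close>
  define c1 c2 where "c1 = 5 * (4 ^ DIM('a) * 2 :: real)" and "c2 = 2 powr u * 2 * 4 ^ DIM('a)"
  have c: "c1 \<ge> 0" "c2 \<ge> 0" by (auto simp: c1_def c2_def)
  show ?thesis
  proof (rule that[of "C * (c1 powr a * c2 powr b)"])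
    show "C * (c1 powr a * c2 powr b) \<ge> 0" using C by simp
    fix f :: "'a \<Rightarrow> real" and g assume f: "\<And>x. GDERIV f x :> g x" and g: "continuous_on UNIV g"
    have fc: "continuous_on UNIV f" by (rule GDERIV_continuous_on[OF f])
    have [measurable]: "g \<in> borel_measurable borel" "f \<in> borel_measurable borel"
      using fc g by (auto intro!: borel_measurable_continuous_onI)
    define D where "D = window_sum (\<lambda>k. 2 powr real_of_int k * dyadic_mean (\<lambda>x. norm (g x)) k) 0"
    define U where "U = window_sum (dyadic_mean (\<lambda>x. \<bar>f x\<bar> powr u)) 0"
    have DU: "D \<ge> 0" "U \<ge> 0" unfolding D_def U_def by (auto intro!: window_sum_nonneg)
    let ?h = "\<lambda>x. f x - f (2 *\<^sub>R x)" and ?g = "\<lambda>x. g x - 2 *\<^sub>R g (2 *\<^sub>R x)"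
    define G where "G = (\<integral>\<^sup>+x\<in>?W'. ennreal (norm (g x)) \<partial>lborel)"
    have G: "G \<le> ennreal (4 ^ DIM('a) * 2 * D)"
      unfolding G_def D_def by (rule nn_integral_window_gradient_le[OF g])
    have dil: "(\<integral>\<^sup>+x\<in>?W. \<phi> x \<partial>lborel) \<le> (\<integral>\<^sup>+x\<in>?W'. \<phi> x \<partial>lborel)"
      "(\<integral>\<^sup>+x\<in>?W. \<phi> (2 *\<^sub>R x) \<partial>lborel) \<le> (\<integral>\<^sup>+x\<in>?W'. \<phi> x \<partial>lborel)"
      if "\<phi> \<in> borel_measurable borel" for \<phi> :: "'a \<Rightarrow> ennreal"
      using nn_integral_dilate_window_le[OF that, of 1] nn_integral_dilate_window_le[OF that, of 2] by auto
    have "(\<integral>\<^sup>+x\<in>?W. ennreal (\<bar>?h x\<bar> + norm (?g x)) \<partial>lborel)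
        \<le> (\<integral>\<^sup>+x. (ennreal \<bar>?h x\<bar> * indicator ?W x + ennreal (norm (g x)) * indicator ?W x
            + 2 * (ennreal (norm (g (2 *\<^sub>R x))) * indicator ?W x)) \<partial>lborel)"
    proof (intro nn_integral_mono)
      fix x
      have "norm (?g x) \<le> norm (g x) + 2 * norm (g (2 *\<^sub>R x))"
        using norm_triangle_ineq4[of "g x" "2 *\<^sub>R g (2 *\<^sub>R x)"] by simp
      then have "ennreal (\<bar>?h x\<bar> + norm (?g x)) \<le> ennreal (\<bar>?h x\<bar> + norm (g x) + 2 * norm (g (2 *\<^sub>R x)))"
        by (intro ennreal_leI) auto
      also have "\<dots> = ennreal \<bar>?h x\<bar> + ennreal (norm (g x)) + 2 * ennreal (norm (g (2 *\<^sub>R x)))"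
        by (simp add: ennreal_mult)
      finally show "ennreal (\<bar>?h x\<bar> + norm (?g x)) * indicator ?W x
        \<le> ennreal \<bar>?h x\<bar> * indicator ?W x + ennreal (norm (g x)) * indicator ?W x
            + 2 * (ennreal (norm (g (2 *\<^sub>R x))) * indicator ?W x)"
        by (simp only: indicator_def) auto
    qed
    also have "\<dots> = (\<integral>\<^sup>+x\<in>?W. ennreal \<bar>?h x\<bar> \<partial>lborel) + (\<integral>\<^sup>+x\<in>?W. ennreal (norm (g x)) \<partial>lborel)
        + 2 * (\<integral>\<^sup>+x\<in>?W. ennreal (norm (g (2 *\<^sub>R x))) \<partial>lborel)"
      by (simp add: nn_integral_add nn_integral_cmult)
    also have "\<dots> \<le> 2 * G + G + 2 * G"
      unfolding G_def by (intro add_mono mult_left_mono nn_integral_dilate_diff_le[OF f g] dil) auto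
    also have "\<dots> = (2 + 1 + 2) * G"
      by (simp only: distrib_right mult_1_left)
    also have "\<dots> = 5 * G" by simp
    also have "\<dots> \<le> 5 * ennreal (4 ^ DIM('a) * 2 * D)"
      by (intro mult_left_mono G) simp
    also have "\<dots> = ennreal (c1 * D)"
      using DU by (simp add: c1_def ennreal_mult[symmetric] flip: ennreal_numeral)
    finally have S: "(\<integral>\<^sup>+x\<in>?W. ennreal (\<bar>?h x\<bar> + norm (?g x)) \<partial>lborel) \<le> ennreal (c1 * D)" .
    have "(\<integral>\<^sup>+x\<in>?W. ennreal (\<bar>?h x\<bar> powr u) \<partial>lborel)
        \<le> (\<integral>\<^sup>+x. ennreal (2 powr u) * (ennreal (\<bar>f x\<bar> powr u) * indicator ?W x
            + ennreal (\<bar>f (2 *\<^sub>R x)\<bar> powr u) * indicator ?W x) \<partial>lborel)"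
    proof (intro nn_integral_mono)
      fix x
      have "\<bar>?h x\<bar> powr u \<le> (2 * max \<bar>f x\<bar> \<bar>f (2 *\<^sub>R x)\<bar>) powr u"
        using pos by (intro powr_mono2) auto
      also have "\<dots> \<le> 2 powr u * (\<bar>f x\<bar> powr u + \<bar>f (2 *\<^sub>R x)\<bar> powr u)"
        by (auto simp: powr_mult max_def)
      finally have "ennreal (\<bar>?h x\<bar> powr u) \<le> ennreal (2 powr u) * (ennreal (\<bar>f x\<bar> powr u) + ennreal (\<bar>f (2 *\<^sub>R x)\<bar> powr u))"
        by (simp add: ennreal_mult[symmetric] ennreal_plus[symmetric] del: ennreal_plus)
      then show "ennreal (\<bar>?h x\<bar> powr u) * indicator ?W x
        \<le> ennreal (2 powr u) * (ennreal (\<bar>f x\<bar> powr u) * indicator ?W x + ennreal (\<bar>f (2 *\<^sub>R x)\<bar> powr u) * indicator ?W x)"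
        by (simp only: indicator_def) auto
    qed
    also have "\<dots> = ennreal (2 powr u) * ((\<integral>\<^sup>+x\<in>?W. ennreal (\<bar>f x\<bar> powr u) \<partial>lborel)
        + (\<integral>\<^sup>+x\<in>?W. ennreal (\<bar>f (2 *\<^sub>R x)\<bar> powr u) \<partial>lborel))"
      by (simp add: nn_integral_add nn_integral_cmult)
    also have "\<dots> \<le> ennreal (2 powr u) * ((\<integral>\<^sup>+x\<in>?W'. ennreal (\<bar>f x\<bar> powr u) \<partial>lborel)
        + (\<integral>\<^sup>+x\<in>?W'. ennreal (\<bar>f x\<bar> powr u) \<partial>lborel))"
      by (intro mult_left_mono add_mono dil) auto
    also have "\<dots> \<le> ennreal (2 powr u) * (ennreal (4 ^ DIM('a) * U) + ennreal (4 ^ DIM('a) * U))"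
      unfolding U_def by (intro mult_left_mono add_mono nn_integral_window_le continuous_on_abs_powr fc pos) auto
    also have "\<dots> = ennreal (c2 * U)"
      using DU by (simp add: c2_def ennreal_mult[symmetric] ennreal_plus[symmetric] del: ennreal_plus)
    finally have V: "(\<integral>\<^sup>+x\<in>?W. ennreal (\<bar>?h x\<bar> powr u) \<partial>lborel) \<le> ennreal (c2 * U)" .
    have "(\<integral>\<^sup>+x\<in>annulus 0. ennreal (\<bar>?h x\<bar> powr q) \<partial>lborel) \<le> ennreal C * (epowr (\<integral>\<^sup>+x\<in>?W. ennreal (\<bar>?h x\<bar> + norm (?g x)) \<partial>lborel) a
      * epowr (\<integral>\<^sup>+x\<in>?W. ennreal (\<bar>?h x\<bar> powr u) \<partial>lborel) b)"
      unfolding a_def b_def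
      by (intro C(2) GDERIV_dilate_diff[OF f] continuous_intros continuous_on_compose2[OF g] g) auto
    also have "\<dots> \<le> ennreal C * (epowr (ennreal (c1 * D)) a * epowr (ennreal (c2 * U)) b)"
      using ab by (intro mult_left_mono mult_mono epowr_mono S V) auto
    also have "\<dots> = ennreal (C * (c1 powr a * c2 powr b) * (D powr a * U powr b))"
      using C(1) c DU by (simp add: epowr_ennreal powr_mult ennreal_mult[symmetric] mult_ac)
    finally show "(\<integral>\<^sup>+x\<in>annulus 0. ennreal (\<bar>f x - f (2 *\<^sub>R x)\<bar> powr q) \<partial>lborel)
      \<le> ennreal (C * (c1 powr a * c2 powr b) * (window_sum (\<lambda>k. 2 powr real_of_int k * dyadic_mean (\<lambda>x. norm (g x)) k) 0 powr (\<theta> * q)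
      * window_sum (dyadic_mean (\<lambda>x. \<bar>f x\<bar> powr u)) 0 powr ((1 - \<theta>) * q / u)))"
      unfolding a_def b_def D_def U_def .
  qed
qed


text \<open>The local inequality for f itself, with its lower-order term. Hoelder's inequality
  bounds the L1 norm of f by the mean of the power u, which is where \<open>u \<ge> 1\<close>
  enters. The estimate serves to make the remainder of the recursion vanish at infinity.\<close>

lemma annulus_interpolation:
  assumes pos: "q > 0" "u \<ge> 1" and \<theta>: "0 \<le> \<theta>" "\<theta> \<le> 1"
    and w: "0 \<le> w" "real DIM('a::euclidean_space) - 1 \<le> real DIM('a) * w" and q: "1 / q = \<theta> * w + (1 - \<theta>) / u"
  obtains C where "C \<ge> 0" "\<And>(f :: 'a \<Rightarrow> real) g. (\<And>x. GDERIV f x :> g x) \<Longrightarrow> continuous_on UNIV g \<Longrightarrow>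
    dyadic_mean (\<lambda>x. \<bar>f x\<bar> powr q) 0
    \<le> C * ((window_sum (\<lambda>k. 2 powr real_of_int k * dyadic_mean (\<lambda>x. norm (g x)) k) 0
        + window_sum (dyadic_mean (\<lambda>x. \<bar>f x\<bar> powr u)) 0 powr (1 / u)) powr (\<theta> * q)
      * window_sum (dyadic_mean (\<lambda>x. \<bar>f x\<bar> powr u)) 0 powr ((1 - \<theta>) * q / u))"
proof -
  have u: "u > 0" using pos by simp
  let ?W = "{x::'a. 1/4 < norm x \<and> norm x < 2}" and ?W' = "{x::'a. 1/4 \<le> norm x \<and> norm x < 4}"
  obtain C where C: "C \<ge> 0" "\<And>(h :: 'a \<Rightarrow> real) g. (\<And>x. GDERIV h x :> g x) \<Longrightarrow> continuous_on UNIV g \<Longrightarrow>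
    (\<integral>\<^sup>+x\<in>annulus 0. ennreal (\<bar>h x\<bar> powr q) \<partial>lborel)
    \<le> ennreal C * (epowr (\<integral>\<^sup>+x\<in>?W. ennreal (\<bar>h x\<bar> + norm (g x)) \<partial>lborel) (\<theta> * q)
      * epowr (\<integral>\<^sup>+x\<in>?W. ennreal (\<bar>h x\<bar> powr u) \<partial>lborel) ((1 - \<theta>) * q / u))"
    using annulus_Gagliardo_Nirenberg[OF pos(1) u \<theta> w q] by blast
  define a b where "a = \<theta> * q" and "b = (1 - \<theta>) * q / u"
  have ab: "a \<ge> 0" "b \<ge> 0" using pos \<theta> by (auto simp: a_def b_def)
  \<comment> \<open>The volume m of the region is the constant in Hoelder's inequality against the
    function 1.\<close>
  have "emeasure lborel ?W \<le> emeasure lborel (cball 0 2 :: 'a set)"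
    by (intro emeasure_mono) auto
  also have "\<dots> < top" using emeasure_bounded_finite[of "cball 0 2 :: 'a set"] by simp
  finally obtain m where m: "emeasure lborel ?W = ennreal m" "m \<ge> 0"
    by (cases "emeasure lborel ?W") auto
  define d where "d = (4::real) ^ DIM('a)"
  have d: "d \<ge> 1" by (simp add: d_def)
  define c1 where "c1 = d * 2 + d powr (1/u) * m powr (1 - 1/u)"
  have c1: "c1 \<ge> 0" using d by (auto simp: c1_def)
  show ?thesis
  proof (rule that[of "C * (c1 powr a * d powr b)"])
    show "C * (c1 powr a * d powr b) \<ge> 0" using C by simp
    fix f :: "'a \<Rightarrow> real" and g assume f: "\<And>x. GDERIV f x :> g x" and g: "continuous_on UNIV g"
    have fc: "continuous_on UNIV f" by (rule GDERIV_continuous_on[OF f])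
    have [measurable]: "g \<in> borel_measurable borel" "f \<in> borel_measurable borel"
      using fc g by (auto intro!: borel_measurable_continuous_onI)
    define D where "D = window_sum (\<lambda>k. 2 powr real_of_int k * dyadic_mean (\<lambda>x. norm (g x)) k) 0"
    define U where "U = window_sum (dyadic_mean (\<lambda>x. \<bar>f x\<bar> powr u)) 0"
    have DU: "D \<ge> 0" "U \<ge> 0" unfolding D_def U_def by (auto intro!: window_sum_nonneg)
    have sub: "(\<integral>\<^sup>+x\<in>?W. \<phi> x \<partial>lborel) \<le> (\<integral>\<^sup>+x\<in>?W'. \<phi> x \<partial>lborel)" for \<phi> :: "'a \<Rightarrow> ennreal"
      by (intro nn_integral_mono) (auto simp: indicator_def)
    have V: "(\<integral>\<^sup>+x\<in>?W. ennreal (\<bar>f x\<bar> powr u) \<partial>lborel) \<le> ennreal (d * U)"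
      unfolding U_def d_def
      by (intro order_trans[OF sub nn_integral_window_le] continuous_on_abs_powr fc u)
    have G: "(\<integral>\<^sup>+x\<in>?W. ennreal (norm (g x)) \<partial>lborel) \<le> ennreal (d * 2 * D)"
      unfolding D_def d_def by (rule order_trans[OF sub nn_integral_window_gradient_le[OF g]])
    have "(\<integral>\<^sup>+x\<in>?W. ennreal \<bar>f x\<bar> \<partial>lborel)
        = (\<integral>\<^sup>+x. epowr (ennreal (\<bar>f x\<bar> powr u) * indicator ?W x) (1/u) * epowr (indicator ?W x) (1 - 1/u) \<partial>lborel)"
      using u by (intro nn_integral_cong) (auto simp: indicator_def epowr_ennreal powr_powr)
    also have "\<dots> \<le> epowr (\<integral>\<^sup>+x\<in>?W. ennreal (\<bar>f x\<bar> powr u) \<partial>lborel) (1/u)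
        * epowr (\<integral>\<^sup>+x. indicator ?W x \<partial>lborel) (1 - 1/u)"
      using pos by (intro nn_integral_Holder2) auto
    also have "\<dots> \<le> epowr (ennreal (d * U)) (1/u) * epowr (ennreal m) (1 - 1/u)"
      using pos m by (intro mult_mono epowr_mono V) auto
    also have "\<dots> = ennreal (d powr (1/u) * m powr (1 - 1/u) * U powr (1/u))"
      using DU d m by (simp add: epowr_ennreal ennreal_mult[symmetric] powr_mult mult_ac)
    finally have F: "(\<integral>\<^sup>+x\<in>?W. ennreal \<bar>f x\<bar> \<partial>lborel) \<le> ennreal (d powr (1/u) * m powr (1 - 1/u) * U powr (1/u))" .
    have "(\<integral>\<^sup>+x\<in>?W. ennreal (\<bar>f x\<bar> + norm (g x)) \<partial>lborel)
        = (\<integral>\<^sup>+x\<in>?W. ennreal \<bar>f x\<bar> \<partial>lborel) + (\<integral>\<^sup>+x\<in>?W. ennreal (norm (g x)) \<partial>lborel)"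
      by (simp add: distrib_right nn_integral_add)
    also have "\<dots> \<le> ennreal (d powr (1/u) * m powr (1 - 1/u) * U powr (1/u)) + ennreal (d * 2 * D)"
      by (intro add_mono F G)
    also have "\<dots> = ennreal (d powr (1/u) * m powr (1 - 1/u) * U powr (1/u) + d * 2 * D)"
      using DU d by (intro ennreal_plus[symmetric]) auto
    also have "\<dots> \<le> ennreal (c1 * (D + U powr (1/u)))"
      using DU d by (intro ennreal_leI) (auto simp: c1_def algebra_simps)
    finally have S: "(\<integral>\<^sup>+x\<in>?W. ennreal (\<bar>f x\<bar> + norm (g x)) \<partial>lborel) \<le> ennreal (c1 * (D + U powr (1/u)))" .
    have "ennreal (dyadic_mean (\<lambda>x. \<bar>f x\<bar> powr q) 0) = (\<integral>\<^sup>+x\<in>annulus 0. ennreal (\<bar>f x\<bar> powr q) \<partial>lborel)"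
      using ennreal_dyadic_mean[OF continuous_on_abs_powr[OF fc pos(1)], of 0] by simp
    also have "\<dots> \<le> ennreal C * (epowr (\<integral>\<^sup>+x\<in>?W. ennreal (\<bar>f x\<bar> + norm (g x)) \<partial>lborel) a
      * epowr (\<integral>\<^sup>+x\<in>?W. ennreal (\<bar>f x\<bar> powr u) \<partial>lborel) b)"
      unfolding a_def b_def by (intro C(2) f g)
    also have "\<dots> \<le> ennreal C * (epowr (ennreal (c1 * (D + U powr (1/u)))) a * epowr (ennreal (d * U)) b)"
      using ab by (intro mult_left_mono mult_mono epowr_mono S V) auto
    also have "\<dots> = ennreal (C * (c1 powr a * d powr b) * ((D + U powr (1/u)) powr a * U powr b))"
      using C(1) c1 d DU by (simp add: epowr_ennreal powr_mult ennreal_mult[symmetric] mult_ac)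
    finally show "dyadic_mean (\<lambda>x. \<bar>f x\<bar> powr q) 0
    \<le> C * (c1 powr a * d powr b) * ((window_sum (\<lambda>k. 2 powr real_of_int k * dyadic_mean (\<lambda>x. norm (g x)) k) 0
        + window_sum (dyadic_mean (\<lambda>x. \<bar>f x\<bar> powr u)) 0 powr (1 / u)) powr (\<theta> * q)
      * window_sum (dyadic_mean (\<lambda>x. \<bar>f x\<bar> powr u)) 0 powr ((1 - \<theta>) * q / u))"
      using C(1) unfolding a_def b_def D_def U_def by (subst (asm) ennreal_le_iff) auto
  qed
qed

text \<open>Pointwise |f(x)| is at most |f(2x)| + |f(x) - f(2x)|, and integrating f(2x) over one
  annulus gives the mean over the next. The scaled sum inequality keeps \<delta> on that term and
  puts the loss on the difference.\<close>

lemma annulus_recursion: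
  assumes pos: "q > 0" "u > 0" and \<theta>: "0 \<le> \<theta>" "\<theta> \<le> 1"
    and w: "0 \<le> w" "real DIM('a::euclidean_space) - 1 \<le> real DIM('a) * w" and q: "1 / q = \<theta> * w + (1 - \<theta>) / u"
    and \<delta>: "\<delta> > 1"
  obtains C where "C \<ge> 0" "\<And>(f :: 'a \<Rightarrow> real) g. (\<And>x. GDERIV f x :> g x) \<Longrightarrow> continuous_on UNIV g \<Longrightarrow>
    dyadic_mean (\<lambda>x. \<bar>f x\<bar> powr q) 0 \<le> \<delta> * dyadic_mean (\<lambda>x. \<bar>f x\<bar> powr q) 1
      + C * (window_sum (\<lambda>k. 2 powr real_of_int k * dyadic_mean (\<lambda>x. norm (g x)) k) 0 powr (\<theta> * q)
      * window_sum (dyadic_mean (\<lambda>x. \<bar>f x\<bar> powr u)) 0 powr ((1 - \<theta>) * q / u))"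
proof -
  obtain C where C: "C \<ge> 0" "\<And>(f :: 'a \<Rightarrow> real) g. (\<And>x. GDERIV f x :> g x) \<Longrightarrow> continuous_on UNIV g \<Longrightarrow>
    (\<integral>\<^sup>+x\<in>annulus 0. ennreal (\<bar>f x - f (2 *\<^sub>R x)\<bar> powr q) \<partial>lborel)
    \<le> ennreal (C * (window_sum (\<lambda>k. 2 powr real_of_int k * dyadic_mean (\<lambda>x. norm (g x)) k) 0 powr (\<theta> * q)
      * window_sum (dyadic_mean (\<lambda>x. \<bar>f x\<bar> powr u)) 0 powr ((1 - \<theta>) * q / u)))"
    using dilate_diff_interpolation[OF pos \<theta> w q] by blast
  obtain K where K: "K \<ge> 0"
    "\<And>a b. a \<ge> 0 \<Longrightarrow> b \<ge> 0 \<Longrightarrow> (a + b) powr q \<le> \<delta> * a powr q + K * b powr q"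
    using powr_add_le_powr_scaled[OF \<delta> pos(1)] by blast
  show ?thesis
  proof (rule that[of "K * C"])
    show "K * C \<ge> 0" using K C by simp
    fix f :: "'a \<Rightarrow> real" and g assume f: "\<And>x. GDERIV f x :> g x" and g: "continuous_on UNIV g"
    have fc: "continuous_on UNIV f" by (rule GDERIV_continuous_on[OF f])
    have [measurable]: "f \<in> borel_measurable borel"
      using fc by (auto intro!: borel_measurable_continuous_onI)
    define R where "R = window_sum (\<lambda>k. 2 powr real_of_int k * dyadic_mean (\<lambda>x. norm (g x)) k) 0 powr (\<theta> * q)
      * window_sum (dyadic_mean (\<lambda>x. \<bar>f x\<bar> powr u)) 0 powr ((1 - \<theta>) * q / u)"
    have R: "R \<ge> 0" by (simp add: R_def)
    let ?X = "dyadic_mean (\<lambda>x. \<bar>f x\<bar> powr q)"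
    have X: "(\<integral>\<^sup>+x\<in>annulus 0. ennreal (\<bar>f x\<bar> powr q) \<partial>lborel) = ennreal (?X 0)"
      "(\<integral>\<^sup>+x\<in>annulus 0. ennreal (\<bar>f (2 *\<^sub>R x)\<bar> powr q) \<partial>lborel) = ennreal (?X 1)"
      using ennreal_dyadic_mean[OF continuous_on_abs_powr[OF fc pos(1)], of 0]
        ennreal_dyadic_mean[OF continuous_on_abs_powr[OF fc pos(1)], of 1] by simp_all
    have "ennreal (?X 0) \<le> (\<integral>\<^sup>+x. (ennreal \<delta> * (ennreal (\<bar>f (2 *\<^sub>R x)\<bar> powr q) * indicator (annulus 0) x)
        + ennreal K * (ennreal (\<bar>f x - f (2 *\<^sub>R x)\<bar> powr q) * indicator (annulus 0) x)) \<partial>lborel)"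
      unfolding X(1)[symmetric]
    proof (intro nn_integral_mono)
      fix x :: 'a
      have "\<bar>f x\<bar> powr q \<le> (\<bar>f (2 *\<^sub>R x)\<bar> + \<bar>f x - f (2 *\<^sub>R x)\<bar>) powr q"
        using pos by (intro powr_mono2) auto
      also have "\<dots> \<le> \<delta> * \<bar>f (2 *\<^sub>R x)\<bar> powr q + K * \<bar>f x - f (2 *\<^sub>R x)\<bar> powr q"
        by (intro K) auto
      finally have "ennreal (\<bar>f x\<bar> powr q) \<le> ennreal \<delta> * ennreal (\<bar>f (2 *\<^sub>R x)\<bar> powr q) + ennreal K * ennreal (\<bar>f x - f (2 *\<^sub>R x)\<bar> powr q)"
        using \<delta> K(1) by (simp add: ennreal_mult[symmetric] ennreal_plus[symmetric] del: ennreal_plus)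
      then show "ennreal (\<bar>f x\<bar> powr q) * indicator (annulus 0) x
        \<le> ennreal \<delta> * (ennreal (\<bar>f (2 *\<^sub>R x)\<bar> powr q) * indicator (annulus 0) x)
        + ennreal K * (ennreal (\<bar>f x - f (2 *\<^sub>R x)\<bar> powr q) * indicator (annulus 0) x)"
        by (simp only: indicator_def) auto
    qed
    also have "\<dots> = ennreal \<delta> * ennreal (?X 1)
        + ennreal K * (\<integral>\<^sup>+x\<in>annulus 0. ennreal (\<bar>f x - f (2 *\<^sub>R x)\<bar> powr q) \<partial>lborel)"
      by (subst nn_integral_add) (auto simp: nn_integral_cmult X(2))
    also have "\<dots> \<le> ennreal \<delta> * ennreal (?X 1) + ennreal K * ennreal (C * R)"
      unfolding R_def by (intro add_left_mono mult_left_mono C(2) f g) auto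
    also have "\<dots> = ennreal (\<delta> * ?X 1 + K * C * R)"
      using \<delta> K(1) C(1) R by (simp add: ennreal_mult[symmetric] ennreal_plus[symmetric] mult.assoc del: ennreal_plus)
    finally show "?X 0 \<le> \<delta> * ?X 1 + K * C * (window_sum (\<lambda>k. 2 powr real_of_int k * dyadic_mean (\<lambda>x. norm (g x)) k) 0 powr (\<theta> * q)
      * window_sum (dyadic_mean (\<lambda>x. \<bar>f x\<bar> powr u)) 0 powr ((1 - \<theta>) * q / u))"
      using \<delta> K(1) C(1) R unfolding R_def by (subst (asm) ennreal_le_iff) auto
  qed
qed

section \<open>Weighted sequences\<close>

lemma sum_Holder2:
  fixes f g :: "'b \<Rightarrow> real"
  assumes fin: "finite F" and nn: "\<And>k. k \<in> F \<Longrightarrow> 0 \<le> f k" "\<And>k. k \<in> F \<Longrightarrow> 0 \<le> g k"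
    and ab: "0 \<le> a" "0 \<le> b" "a + b = 1"
  shows "(\<Sum>k\<in>F. f k powr a * g k powr b) \<le> (\<Sum>k\<in>F. f k) powr a * (\<Sum>k\<in>F. g k) powr b"
proof -
  have "ennreal (\<Sum>k\<in>F. f k powr a * g k powr b)
      = (\<integral>\<^sup>+k. epowr (ennreal (f k)) a * epowr (ennreal (g k)) b \<partial>count_space F)"
    using fin nn by (subst nn_integral_count_space_finite)
      (auto simp: epowr_ennreal ennreal_mult[symmetric] intro!: sum_ennreal[symmetric] sum.cong)
  also have "\<dots> \<le> epowr (\<integral>\<^sup>+k. ennreal (f k) \<partial>count_space F) a * epowr (\<integral>\<^sup>+k. ennreal (g k) \<partial>count_space F) b"
    using ab by (intro nn_integral_Holder2) auto
  also have "\<dots> = ennreal ((\<Sum>k\<in>F. f k) powr a * (\<Sum>k\<in>F. g k) powr b)"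
    using fin nn by (simp add: nn_integral_count_space_finite epowr_ennreal ennreal_mult sum_nonneg)
  finally show ?thesis
    by (subst (asm) ennreal_le_iff) auto
qed

text \<open>A sum is at most its number of terms times the largest one; this treats powers below and
  above 1 alike.\<close>

lemma powr_sum_le:
  fixes a :: "'b \<Rightarrow> real"
  assumes "finite J" "J \<noteq> {}" "\<And>j. j \<in> J \<Longrightarrow> 0 \<le> a j" "p > 0"
  shows "(\<Sum>j\<in>J. a j) powr p \<le> real (card J) powr p * (\<Sum>j\<in>J. a j powr p)"
proof -
  obtain i where i: "i \<in> J" "\<And>j. j \<in> J \<Longrightarrow> a j \<le> a i"
  proof -
    have "Max (a ` J) \<in> a ` J" using assms(1,2) by (intro Max_in) auto
    then obtain i where "i \<in> J" "a i = Max (a ` J)" by auto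
    then show ?thesis using assms(1) by (intro that) auto
  qed
  have "(\<Sum>j\<in>J. a j) \<le> real (card J) * a i"
    using i by (intro sum_bounded_above) auto
  then have "(\<Sum>j\<in>J. a j) powr p \<le> (real (card J) * a i) powr p"
    using assms by (intro powr_mono2 sum_nonneg) auto
  also have "\<dots> = real (card J) powr p * a i powr p"
    using assms(3) i by (simp add: powr_mult)
  also have "\<dots> \<le> real (card J) powr p * (\<Sum>j\<in>J. a j powr p)"
    using assms i by (intro mult_left_mono member_le_sum) auto
  finally show ?thesis .
qed

text \<open>Each index lies in four windows, and a shift by at most 2 changes the weight by at most
  the factor \<open>2 powr (2 * \<bar>\<gamma>\<bar>)\<close>; \<open>4 powr p\<close> is the price
  of a power of four summands. As S bounds all finite partial sums, it bounds the shifted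
  ones.\<close>

lemma weighted_window_sum_le:
  fixes a :: "int \<Rightarrow> real"
  assumes a: "\<And>k. 0 \<le> a k" and p: "p > 0"
    and S: "\<And>F. finite F \<Longrightarrow> (\<Sum>k\<in>F. 2 powr (real_of_int k * \<gamma>) * a k powr p) \<le> S"
    and F: "finite F"
  shows "(\<Sum>k\<in>F. 2 powr (real_of_int k * \<gamma>) * window_sum a k powr p) \<le> 4 powr p * 4 * 2 powr (2 * \<bar>\<gamma>\<bar>) * S"
proof -
  have "(\<Sum>k\<in>F. 2 powr (real_of_int k * \<gamma>) * window_sum a k powr p)
      \<le> (\<Sum>k\<in>F. \<Sum>j\<in>{-1..2}. 4 powr p * 2 powr (2 * \<bar>\<gamma>\<bar>) * (2 powr (real_of_int (k + j) * \<gamma>) * a (k + j) powr p))"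
  proof (intro sum_mono)
    fix k
    have "window_sum a k powr p \<le> 4 powr p * (\<Sum>j\<in>{-1..2}. a (k + j) powr p)"
      unfolding window_sum_def using powr_sum_le[of "{-1..2::int}" "\<lambda>j. a (k + j)" p] a p by simp
    then have "2 powr (real_of_int k * \<gamma>) * window_sum a k powr p
        \<le> 2 powr (real_of_int k * \<gamma>) * (4 powr p * (\<Sum>j\<in>{-1..2}. a (k + j) powr p))"
      by (rule mult_left_mono) simp
    also have "\<dots> = (\<Sum>j\<in>{-1..2}. 4 powr p * a (k + j) powr p * 2 powr (real_of_int k * \<gamma>))"
      by (simp add: sum_distrib_left mult_ac)
    also have "\<dots> \<le> (\<Sum>j\<in>{-1..2}. 4 powr p * a (k + j) powr p * (2 powr (2 * \<bar>\<gamma>\<bar>) * 2 powr (real_of_int (k + j) * \<gamma>)))"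
    proof (intro sum_mono mult_left_mono)
      fix j :: int assume j: "j \<in> {-1..2}"
      have "- (real_of_int j * \<gamma>) \<le> \<bar>real_of_int j\<bar> * \<bar>\<gamma>\<bar>"
        by (metis abs_ge_minus_self abs_mult)
      also have "\<dots> \<le> 2 * \<bar>\<gamma>\<bar>" using j by (intro mult_right_mono) auto
      finally show "2 powr (real_of_int k * \<gamma>) \<le> 2 powr (2 * \<bar>\<gamma>\<bar>) * 2 powr (real_of_int (k + j) * \<gamma>)"
        by (simp add: powr_add[symmetric] algebra_simps)
    qed auto
    finally show "2 powr (real_of_int k * \<gamma>) * window_sum a k powr p
      \<le> (\<Sum>j\<in>{-1..2}. 4 powr p * 2 powr (2 * \<bar>\<gamma>\<bar>) * (2 powr (real_of_int (k + j) * \<gamma>) * a (k + j) powr p))"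
      by (simp add: mult_ac)
  qed
  also have "\<dots> = (\<Sum>j\<in>{-1..2}. 4 powr p * 2 powr (2 * \<bar>\<gamma>\<bar>) * (\<Sum>k\<in>F. 2 powr (real_of_int (k + j) * \<gamma>) * a (k + j) powr p))"
    by (subst sum.swap) (simp add: sum_distrib_left)
  also have "\<dots> \<le> (\<Sum>j\<in>{-1..2::int}. 4 powr p * 2 powr (2 * \<bar>\<gamma>\<bar>) * S)"
  proof (intro sum_mono mult_left_mono)
    fix j :: int
    have "(\<Sum>k\<in>F. 2 powr (real_of_int (k + j) * \<gamma>) * a (k + j) powr p)
        = (\<Sum>k\<in>(\<lambda>k. k + j) ` F. 2 powr (real_of_int k * \<gamma>) * a k powr p)"
      by (subst sum.reindex) (auto simp: inj_on_def)
    also have "\<dots> \<le> S" using F by (intro S) auto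
    finally show "(\<Sum>k\<in>F. 2 powr (real_of_int (k + j) * \<gamma>) * a (k + j) powr p) \<le> S" .
  qed auto
  also have "\<dots> = 4 powr p * 4 * 2 powr (2 * \<bar>\<gamma>\<bar>) * S" by simp
  finally show ?thesis .
qed

lemma iterate_recursion:
  fixes x y :: "int \<Rightarrow> real"
  assumes rec: "\<And>k. x k \<le> \<eta> * x (k + 1) + y k" and \<eta>: "\<eta> \<ge> 0"
  shows "x k \<le> \<eta> ^ M * x (k + int M) + (\<Sum>j<M. \<eta> ^ j * y (k + int j))"
proof (induction M)
  case (Suc M)
  have "\<eta> ^ M * x (k + int M) \<le> \<eta> ^ M * (\<eta> * x (k + int M + 1) + y (k + int M))"
    using \<eta> by (intro mult_left_mono rec) auto
  also have "\<dots> = \<eta> ^ Suc M * x (k + int (Suc M)) + \<eta> ^ M * y (k + int M)"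
    by (simp add: algebra_simps)
  finally show ?case using Suc by simp
qed simp

text \<open>The error of the recursion has weight \<kappa>, so passing from index
  \<open>k + j\<close> to k gains \<open>2 powr (- j * \<kappa> * r)\<close>. The iterated
  coefficient grows at no more than half that rate, and a geometric series remains. \<open>A\<close>
  may have any sign. \<open>L\<close> is absent from the conclusion because \<open>bd\<close> is
  used only for a limit.\<close>

lemma dyadic_sequence_interpolation:
  fixes a e x :: "int \<Rightarrow> real"
  assumes pos: "r > 0" "s > 0" "v > 0" "0 \<le> \<theta>" "\<theta> \<le> 1"
    and r: "1 / r = \<theta> / s + (1 - \<theta>) / v"
    and \<kappa>: "\<kappa> = \<theta> * A + (1 - \<theta>) * B" "\<kappa> > 0" and B: "B > 0"
    and nn: "\<And>k. 0 \<le> a k" "\<And>k. 0 \<le> e k" "\<And>k. 0 \<le> x k"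
    and rec: "\<And>k. x k \<le> 2 powr (r * min \<kappa> B / 2) * x (k + 1) + K * (a k powr (\<theta> * r) * e k powr ((1 - \<theta>) * r))"
    and bd: "\<And>k. x k \<le> L * ((a k + e k) powr (\<theta> * r) * e k powr ((1 - \<theta>) * r))"
    and K: "K \<ge> 0" "L \<ge> 0"
    and P: "\<And>F. finite F \<Longrightarrow> (\<Sum>k\<in>F. (2 powr (real_of_int k * A) * a k) powr s) \<le> P"
    and Q: "\<And>F. finite F \<Longrightarrow> (\<Sum>k\<in>F. (2 powr (real_of_int k * B) * e k) powr v) \<le> Q"
    and F: "finite F"
  shows "(\<Sum>k\<in>F. 2 powr (real_of_int k * \<kappa> * r) * x k)
    \<le> K / (1 - 2 powr (r * min \<kappa> B / 2 - \<kappa> * r)) * (P powr (\<theta> * r / s) * Q powr ((1 - \<theta>) * r / v))"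
proof -
  \<comment> \<open>The decay rate that \<open>bd\<close> yields, as
    \<open>\<theta> * min A B + (1 - \<theta>) * B = min \<kappa> B\<close>. Half of it is spent on
    the growth of \<eta>, the other half makes the remainder vanish.\<close>
  define m where "m = min \<kappa> B"
  define \<eta> where "\<eta> = 2 powr (r * m / 2)"
  define \<rho> where "\<rho> = 2 powr (r * m / 2 - \<kappa> * r)"
  define y where "y k = K * (a k powr (\<theta> * r) * e k powr ((1 - \<theta>) * r))" for k
  define Z where "Z = P powr (\<theta> * r / s) * Q powr ((1 - \<theta>) * r / v)"
  have m: "m > 0" "m \<le> \<kappa>" using \<kappa> B by (auto simp: m_def)
  have "r * m / 2 - \<kappa> * r < 0"
    using m pos mult_left_mono[of m \<kappa> r] \<kappa>(2) mult_pos_pos[OF pos(1) m(1)] by (simp add: mult.commute)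
  then have \<rho>: "0 < \<rho>" "\<rho> < 1" by (auto simp: \<rho>_def powr_less_one)
  have PQ: "P \<ge> 0" "Q \<ge> 0" using P[of "{}"] Q[of "{}"] by auto
  have Hol: "(\<Sum>k\<in>F. 2 powr (real_of_int k * \<kappa> * r) * (a k powr (\<theta> * r) * e k powr ((1 - \<theta>) * r))) \<le> Z"
    if F: "finite F" for F
  proof -
    \<comment> \<open>Conjugate weights by the relation for \<open>1 / r\<close>; writing \<kappa>
      as the mean of \<open>A\<close> and \<open>B\<close> distributes the power of 2 over the two
      factors.\<close>
    define \<alpha> \<beta> where "\<alpha> = \<theta> * r / s" and "\<beta> = (1 - \<theta>) * r / v"
    have "\<alpha> + \<beta> = r * (1 / r)" unfolding \<alpha>_def \<beta>_def r by (simp add: algebra_simps)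
    then have \<alpha>\<beta>: "\<alpha> \<ge> 0" "\<beta> \<ge> 0" "\<alpha> + \<beta> = 1" using pos by (auto simp: \<alpha>_def \<beta>_def)
    have s\<alpha>: "s * \<alpha> = \<theta> * r" "v * \<beta> = (1 - \<theta>) * r" using pos by (auto simp: \<alpha>_def \<beta>_def)
    have "2 powr (real_of_int k * \<kappa> * r) * (a k powr (\<theta> * r) * e k powr ((1 - \<theta>) * r))
        = ((2 powr (real_of_int k * A) * a k) powr s) powr \<alpha> * ((2 powr (real_of_int k * B) * e k) powr v) powr \<beta>" for k
    proof -
      have "real_of_int k * \<kappa> * r = real_of_int k * A * (\<theta> * r) + real_of_int k * B * ((1 - \<theta>) * r)"
        unfolding \<kappa> by (simp add: algebra_simps)
      then show ?thesis
        unfolding powr_powr s\<alpha> using nn by (simp add: powr_powr powr_mult powr_add)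
    qed
    then have "(\<Sum>k\<in>F. 2 powr (real_of_int k * \<kappa> * r) * (a k powr (\<theta> * r) * e k powr ((1 - \<theta>) * r)))
        = (\<Sum>k\<in>F. ((2 powr (real_of_int k * A) * a k) powr s) powr \<alpha> * ((2 powr (real_of_int k * B) * e k) powr v) powr \<beta>)"
      by simp
    also have "\<dots> \<le> (\<Sum>k\<in>F. (2 powr (real_of_int k * A) * a k) powr s) powr \<alpha> * (\<Sum>k\<in>F. (2 powr (real_of_int k * B) * e k) powr v) powr \<beta>"
      using F \<alpha>\<beta> by (intro sum_Holder2) auto
    also have "\<dots> \<le> P powr \<alpha> * Q powr \<beta>"
      using F \<alpha>\<beta> by (intro mult_mono powr_mono2 P Q sum_nonneg) auto
    finally show ?thesis by (simp add: Z_def \<alpha>_def \<beta>_def)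
  qed
  have Z0: "Z \<ge> 0" by (simp add: Z_def)
  \<comment> \<open>The sums over singletons give pointwise bounds.\<close>
  have ak: "a k \<le> P powr (1/s) * 2 powr (- real_of_int k * A)"
    and ek: "e k \<le> Q powr (1/v) * 2 powr (- real_of_int k * B)" for k
  proof -
    have le: "z \<le> p * 2 powr (- real_of_int k * t)" if "2 powr (real_of_int k * t) * z \<le> p" for z p t
    proof -
      have e: "2 powr (real_of_int k * t) * 2 powr (- real_of_int k * t) = (1::real)"
        by (simp add: powr_add[symmetric])
      have "z = z * (2 powr (real_of_int k * t) * 2 powr (- real_of_int k * t))"
        by (simp only: e mult_1_right)
      also have "\<dots> = 2 powr (real_of_int k * t) * z * 2 powr (- real_of_int k * t)"
        by (simp only: mult_ac)
      also have "\<dots> \<le> p * 2 powr (- real_of_int k * t)"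
        using that by (intro mult_right_mono) auto
      finally show ?thesis .
    qed
    have "((2 powr (real_of_int k * A) * a k) powr s) powr (1/s) \<le> P powr (1/s)"
      using P[of "{k}"] pos by (intro powr_mono2) auto
    then show "a k \<le> P powr (1/s) * 2 powr (- real_of_int k * A)"
      using pos(2) nn by (intro le) (simp add: powr_powr)
    have "((2 powr (real_of_int k * B) * e k) powr v) powr (1/v) \<le> Q powr (1/v)"
      using Q[of "{k}"] pos by (intro powr_mono2) auto
    then show "e k \<le> Q powr (1/v) * 2 powr (- real_of_int k * B)"
      using pos(3) nn by (intro le) (simp add: powr_powr)
  qed
  define p1 p2 where "p1 = P powr (1/s) + Q powr (1/v)" and "p2 = Q powr (1/v)"
  define c where "c = L * (p1 powr (\<theta> * r) * p2 powr ((1 - \<theta>) * r))"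
  have c0: "c \<ge> 0" using K by (simp add: c_def)
  have p0: "p1 \<ge> 0" "p2 \<ge> 0" by (auto simp: p1_def p2_def)
  have decay: "x k \<le> c * 2 powr (- (real_of_int k * r * m))" if k: "k \<ge> 0" for k
  proof -
    \<comment> \<open>The sum \<open>a k + e k\<close> is governed by the smaller of the two rates.
      It may be negative; the second factor, with rate \<open>B\<close>, compensates for
      this.\<close>
    define \<mu> where "\<mu> = min A B"
    have mle: "m \<le> \<theta> * \<mu> + (1 - \<theta>) * B"
      by (auto simp: m_def \<mu>_def min_def \<kappa> algebra_simps)
    have \<mu>: "- real_of_int k * A \<le> - real_of_int k * \<mu>" "- real_of_int k * B \<le> - real_of_int k * \<mu>"
      using k by (intro mult_left_mono_neg; simp add: \<mu>_def)+
    have "a k + e k \<le> P powr (1/s) * 2 powr (- real_of_int k * A) + Q powr (1/v) * 2 powr (- real_of_int k * B)"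
      by (intro add_mono ak ek)
    also have "\<dots> \<le> P powr (1/s) * 2 powr (- real_of_int k * \<mu>) + Q powr (1/v) * 2 powr (- real_of_int k * \<mu>)"
      by (rule add_mono[OF mult_left_mono[OF powr_mono[OF \<mu>(1)]] mult_left_mono[OF powr_mono[OF \<mu>(2)]]]) auto
    finally have ae: "a k + e k \<le> p1 * 2 powr (- real_of_int k * \<mu>)"
      by (simp add: p1_def distrib_right)
    have "x k \<le> L * ((a k + e k) powr (\<theta> * r) * e k powr ((1 - \<theta>) * r))" by (rule bd)
    also have "\<dots> \<le> L * ((p1 * 2 powr (- real_of_int k * \<mu>)) powr (\<theta> * r)
        * (p2 * 2 powr (- real_of_int k * B)) powr ((1 - \<theta>) * r))"
      using K pos nn ek[of k] unfolding p2_def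
      by (intro mult_left_mono mult_mono powr_mono2 ae add_nonneg_nonneg) auto
    also have "\<dots> = c * (2 powr (- real_of_int k * \<mu> * (\<theta> * r)) * 2 powr (- real_of_int k * B * ((1 - \<theta>) * r)))"
      using p0 by (simp add: c_def powr_mult powr_powr)
    also have "2 powr (- real_of_int k * \<mu> * (\<theta> * r)) * 2 powr (- real_of_int k * B * ((1 - \<theta>) * r))
        = 2 powr (- (real_of_int k * r) * (\<theta> * \<mu> + (1 - \<theta>) * B))"
      by (simp add: powr_add[symmetric] algebra_simps)
    also have "c * \<dots> \<le> c * 2 powr (- (real_of_int k * r) * m)"
    proof (rule mult_left_mono[OF powr_mono c0])
      show "- (real_of_int k * r) * (\<theta> * \<mu> + (1 - \<theta>) * B) \<le> - (real_of_int k * r) * m"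
        using mle k pos by (intro mult_left_mono_neg) auto
    qed simp
    finally show ?thesis by simp
  qed
  \<comment> \<open>The growth rate \<open>r * m / 2\<close> of the coefficient meets the decay rate
    \<open>r * m\<close> of x. The decay bound is available once \<open>k + int M \<ge> 0\<close>,
    hence the threshold \<open>nat (- k)\<close>.\<close>
  have lim: "(\<lambda>M. \<eta> ^ M * x (k + int M)) \<longlonglongrightarrow> 0" for k
  proof (rule tendsto_sandwich[OF _ _ tendsto_const])
    show "\<forall>\<^sub>F M in sequentially. 0 \<le> \<eta> ^ M * x (k + int M)"
      using nn by (auto simp: \<eta>_def)
    show "\<forall>\<^sub>F M in sequentially. \<eta> ^ M * x (k + int M) \<le> c * 2 powr (- (real_of_int k * r * m)) * (2 powr (- (r * m / 2))) ^ M"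
      using eventually_ge_at_top[of "nat (- k)"]
    proof eventually_elim
      case (elim M)
      then have "\<eta> ^ M * x (k + int M) \<le> \<eta> ^ M * (c * 2 powr (- (real_of_int (k + int M) * r * m)))"
        by (intro mult_left_mono decay) (auto simp: \<eta>_def)
      also have "\<dots> = c * (2 powr (real M * (r * m / 2)) * 2 powr (- (real_of_int (k + int M) * r * m)))"
        by (simp add: \<eta>_def powr_realpow[symmetric] powr_powr mult_ac)
      also have "\<dots> = c * (2 powr (- (real_of_int k * r * m)) * 2 powr (real M * (- (r * m / 2))))"
        by (simp add: powr_add[symmetric] algebra_simps)
      also have "\<dots> = c * 2 powr (- (real_of_int k * r * m)) * (2 powr (- (r * m / 2))) ^ M"
        by (simp add: powr_realpow[symmetric] powr_powr mult_ac)
      finally show ?case .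
    qed
    have "2 powr (- (r * m / 2)) < 1" using pos m by (intro powr_less_one) auto
    then show "(\<lambda>M. c * 2 powr (- (real_of_int k * r * m)) * (2 powr (- (r * m / 2))) ^ M) \<longlonglongrightarrow> 0"
      by (intro tendsto_mult_right_zero LIMSEQ_power_zero) auto
  qed
  \<comment> \<open>The bound for the accumulated errors does not depend on \<open>M\<close>, so
    \<open>M\<close> can tend to infinity for fixed \<open>F\<close>.\<close>
  have step: "(\<Sum>k\<in>F. 2 powr (real_of_int k * \<kappa> * r) * x k)
      \<le> (\<Sum>k\<in>F. 2 powr (real_of_int k * \<kappa> * r) * (\<eta> ^ M * x (k + int M))) + K / (1 - \<rho>) * Z" for M
  proof -
    have "(\<Sum>k\<in>F. 2 powr (real_of_int k * \<kappa> * r) * x k)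
        \<le> (\<Sum>k\<in>F. 2 powr (real_of_int k * \<kappa> * r) * (\<eta> ^ M * x (k + int M) + (\<Sum>j<M. \<eta> ^ j * y (k + int j))))"
      using rec by (intro sum_mono mult_left_mono iterate_recursion) (auto simp: \<eta>_def y_def m_def)
    also have "\<dots> = (\<Sum>k\<in>F. 2 powr (real_of_int k * \<kappa> * r) * (\<eta> ^ M * x (k + int M)))
        + (\<Sum>k\<in>F. \<Sum>j<M. 2 powr (real_of_int k * \<kappa> * r) * (\<eta> ^ j * y (k + int j)))"
      by (simp add: distrib_left sum.distrib sum_distrib_left)
    also have "(\<Sum>k\<in>F. \<Sum>j<M. 2 powr (real_of_int k * \<kappa> * r) * (\<eta> ^ j * y (k + int j)))
        = (\<Sum>j<M. \<rho> ^ j * (\<Sum>k\<in>F. 2 powr (real_of_int (k + int j) * \<kappa> * r) * y (k + int j)))"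
    proof (subst sum.swap, unfold sum_distrib_left, intro sum.cong refl)
      fix j k
      have \<rho>j: "\<rho> ^ j = \<eta> ^ j * 2 powr (- (real j * \<kappa> * r))"
        by (simp add: \<rho>_def \<eta>_def powr_realpow[symmetric] powr_powr powr_add[symmetric] algebra_simps)
      have "2 powr (real_of_int k * \<kappa> * r) = 2 powr (- (real j * \<kappa> * r)) * 2 powr (real_of_int (k + int j) * \<kappa> * r)"
        by (simp add: powr_add[symmetric] algebra_simps)
      then show "2 powr (real_of_int k * \<kappa> * r) * (\<eta> ^ j * y (k + int j))
        = \<rho> ^ j * (2 powr (real_of_int (k + int j) * \<kappa> * r) * y (k + int j))"
        unfolding \<rho>j by (simp only: mult_ac)
    qed
    also have "\<dots> \<le> (\<Sum>j<M. \<rho> ^ j * (K * Z))"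
    proof (intro sum_mono mult_left_mono)
      fix j
      have "(\<Sum>k\<in>F. 2 powr (real_of_int (k + int j) * \<kappa> * r) * y (k + int j))
          = (\<Sum>k\<in>(\<lambda>k. k + int j) ` F. 2 powr (real_of_int k * \<kappa> * r) * y k)"
        by (subst sum.reindex) (auto simp: inj_on_def)
      also have "\<dots> = K * (\<Sum>k\<in>(\<lambda>k. k + int j) ` F. 2 powr (real_of_int k * \<kappa> * r) * (a k powr (\<theta> * r) * e k powr ((1 - \<theta>) * r)))"
        by (simp add: y_def sum_distrib_left mult_ac)
      also have "\<dots> \<le> K * Z" using K F by (intro mult_left_mono Hol) auto
      finally show "(\<Sum>k\<in>F. 2 powr (real_of_int (k + int j) * \<kappa> * r) * y (k + int j)) \<le> K * Z" .
    qed (use \<rho> in auto)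
    also have "\<dots> = (\<Sum>j<M. \<rho> ^ j) * (K * Z)" by (simp add: sum_distrib_right)
    also have "\<dots> \<le> (1 / (1 - \<rho>)) * (K * Z)"
    proof (intro mult_right_mono)
      have "(\<Sum>j<M. \<rho> ^ j) \<le> (\<Sum>j. \<rho> ^ j)"
        using \<rho> by (intro sum_le_suminf summable_geometric) auto
      then show "(\<Sum>j<M. \<rho> ^ j) \<le> 1 / (1 - \<rho>)"
        using \<rho> by (simp add: suminf_geometric)
    qed (use K Z0 in auto)
    finally show ?thesis by simp
  qed
  have "(\<lambda>M. (\<Sum>k\<in>F. 2 powr (real_of_int k * \<kappa> * r) * (\<eta> ^ M * x (k + int M))) + K / (1 - \<rho>) * Z)
      \<longlonglongrightarrow> (\<Sum>k\<in>F. 2 powr (real_of_int k * \<kappa> * r) * 0) + K / (1 - \<rho>) * Z"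
    by (intro tendsto_intros lim)
  then have "(\<Sum>k\<in>F. 2 powr (real_of_int k * \<kappa> * r) * x k) \<le> (\<Sum>k\<in>F. 2 powr (real_of_int k * \<kappa> * r) * 0) + K / (1 - \<rho>) * Z"
    using step by (intro LIMSEQ_le_const) auto
  then show ?thesis by (simp add: \<rho>_def m_def Z_def)
qed

section \<open>Herz norms\<close>

text \<open>The factor \<open>2 powr k\<close> is the one the chain rule gives to the gradient of
  f(2^k x). Rescaling f thus shifts the index and costs no constant.\<close>

definition dyadic_gradient :: "('a::euclidean_space \<Rightarrow> 'a) \<Rightarrow> int \<Rightarrow> real" where
  "dyadic_gradient g k = 2 powr real_of_int k * dyadic_mean (\<lambda>x. norm (g x)) k"

lemma dyadic_gradient_nonneg [simp]: "0 \<le> dyadic_gradient g k"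
  by (simp add: dyadic_gradient_def)

lemma window_sum_dilate:
  fixes f :: "'a::euclidean_space \<Rightarrow> real" and g :: "'a \<Rightarrow> 'a"
  assumes g: "continuous_on UNIV g"
  shows "window_sum (dyadic_mean (\<lambda>x. \<bar>f ((2 powr real_of_int k) *\<^sub>R x)\<bar> powr u)) 0
      = window_sum (dyadic_mean (\<lambda>x. \<bar>f x\<bar> powr u)) k"
    and "window_sum (dyadic_gradient (\<lambda>x. (2 powr real_of_int k) *\<^sub>R g ((2 powr real_of_int k) *\<^sub>R x))) 0
      = window_sum (dyadic_gradient g) k"
proof -
  show "window_sum (dyadic_mean (\<lambda>x. \<bar>f ((2 powr real_of_int k) *\<^sub>R x)\<bar> powr u)) 0
      = window_sum (dyadic_mean (\<lambda>x. \<bar>f x\<bar> powr u)) k"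
    unfolding window_sum_def dyadic_mean_dilate[where \<phi> = "\<lambda>x. \<bar>f x\<bar> powr u"] by (simp add: add.commute)
  have [measurable]: "g \<in> borel_measurable borel"
    using g by (auto intro!: borel_measurable_continuous_onI)
  have "dyadic_gradient (\<lambda>x. (2 powr real_of_int k) *\<^sub>R g ((2 powr real_of_int k) *\<^sub>R x)) j
      = dyadic_gradient g (j + k)" for j
    using dyadic_mean_cmult[of "2 powr real_of_int k" "\<lambda>x. norm (g ((2 powr real_of_int k) *\<^sub>R x))" j]
      dyadic_mean_dilate[of "\<lambda>x. norm (g x)" k j]
    by (simp add: dyadic_gradient_def powr_add)
  then show "window_sum (dyadic_gradient (\<lambda>x. (2 powr real_of_int k) *\<^sub>R g ((2 powr real_of_int k) *\<^sub>R x))) 0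
      = window_sum (dyadic_gradient g) k"
    by (simp add: window_sum_def add.commute)
qed

text \<open>The estimates on \<open>annulus 0\<close> are applied to f(2^k x), so \<open>K\<close>
  and \<open>L\<close> serve all k and all f.\<close>

lemma dyadic_estimates:
  assumes pos: "q > 0" "u \<ge> 1" and \<theta>: "0 \<le> \<theta>" "\<theta> \<le> 1"
    and w: "0 \<le> w" "real DIM('a::euclidean_space) - 1 \<le> real DIM('a) * w" and q: "1 / q = \<theta> * w + (1 - \<theta>) / u"
    and \<delta>: "\<delta> > 1"
  obtains K L where "K \<ge> 0" "L \<ge> 0"
    "\<And>(f :: 'a \<Rightarrow> real) g k. (\<And>x. GDERIV f x :> g x) \<Longrightarrow> continuous_on UNIV g \<Longrightarrow>
      dyadic_mean (\<lambda>x. \<bar>f x\<bar> powr q) k \<le> \<delta> * dyadic_mean (\<lambda>x. \<bar>f x\<bar> powr q) (k + 1)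
        + K * (window_sum (dyadic_gradient g) k powr (\<theta> * q)
          * window_sum (dyadic_mean (\<lambda>x. \<bar>f x\<bar> powr u)) k powr ((1 - \<theta>) * q / u))"
    "\<And>(f :: 'a \<Rightarrow> real) g k. (\<And>x. GDERIV f x :> g x) \<Longrightarrow> continuous_on UNIV g \<Longrightarrow>
      dyadic_mean (\<lambda>x. \<bar>f x\<bar> powr q) k
      \<le> L * ((window_sum (dyadic_gradient g) k + window_sum (dyadic_mean (\<lambda>x. \<bar>f x\<bar> powr u)) k powr (1 / u)) powr (\<theta> * q)
          * window_sum (dyadic_mean (\<lambda>x. \<bar>f x\<bar> powr u)) k powr ((1 - \<theta>) * q / u))"
proof -
  have u: "u > 0" using pos by simp
  obtain K where K: "K \<ge> 0" "\<And>(f :: 'a \<Rightarrow> real) g. (\<And>x. GDERIV f x :> g x) \<Longrightarrow> continuous_on UNIV g \<Longrightarrow>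
    dyadic_mean (\<lambda>x. \<bar>f x\<bar> powr q) 0 \<le> \<delta> * dyadic_mean (\<lambda>x. \<bar>f x\<bar> powr q) 1
      + K * (window_sum (dyadic_gradient g) 0 powr (\<theta> * q)
        * window_sum (dyadic_mean (\<lambda>x. \<bar>f x\<bar> powr u)) 0 powr ((1 - \<theta>) * q / u))"
    unfolding dyadic_gradient_def using annulus_recursion[OF pos(1) u \<theta> w q \<delta>] by blast
  obtain L where L: "L \<ge> 0" "\<And>(f :: 'a \<Rightarrow> real) g. (\<And>x. GDERIV f x :> g x) \<Longrightarrow> continuous_on UNIV g \<Longrightarrow>
    dyadic_mean (\<lambda>x. \<bar>f x\<bar> powr q) 0
    \<le> L * ((window_sum (dyadic_gradient g) 0 + window_sum (dyadic_mean (\<lambda>x. \<bar>f x\<bar> powr u)) 0 powr (1 / u)) powr (\<theta> * q)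
        * window_sum (dyadic_mean (\<lambda>x. \<bar>f x\<bar> powr u)) 0 powr ((1 - \<theta>) * q / u))"
    unfolding dyadic_gradient_def using annulus_interpolation[OF pos \<theta> w q] by blast
  show ?thesis
  proof (rule that[OF K(1) L(1)])
    fix f :: "'a \<Rightarrow> real" and g and k :: int
    assume f: "\<And>x. GDERIV f x :> g x" and g: "continuous_on UNIV g"
    let ?c = "2 powr real_of_int k"
    have f': "GDERIV (\<lambda>x. f (?c *\<^sub>R x)) x :> ?c *\<^sub>R g (?c *\<^sub>R x)" for x
      using GDERIV_affine[OF f, of 0 ?c] by simp
    have g': "continuous_on UNIV (\<lambda>x. ?c *\<^sub>R g (?c *\<^sub>R x))"
      using continuous_on_affine[OF g, of ?c 0] by simp
    have X: "dyadic_mean (\<lambda>x. \<bar>f (?c *\<^sub>R x)\<bar> powr q) j = dyadic_mean (\<lambda>x. \<bar>f x\<bar> powr q) (j + k)" for j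
      by (rule dyadic_mean_dilate[where \<phi> = "\<lambda>x. \<bar>f x\<bar> powr q"])
    show "dyadic_mean (\<lambda>x. \<bar>f x\<bar> powr q) k \<le> \<delta> * dyadic_mean (\<lambda>x. \<bar>f x\<bar> powr q) (k + 1)
        + K * (window_sum (dyadic_gradient g) k powr (\<theta> * q)
          * window_sum (dyadic_mean (\<lambda>x. \<bar>f x\<bar> powr u)) k powr ((1 - \<theta>) * q / u))"
      using K(2)[OF f' g'] unfolding X window_sum_dilate[OF g]
      by (simp add: add.commute)
    show "dyadic_mean (\<lambda>x. \<bar>f x\<bar> powr q) k
      \<le> L * ((window_sum (dyadic_gradient g) k + window_sum (dyadic_mean (\<lambda>x. \<bar>f x\<bar> powr u)) k powr (1 / u)) powr (\<theta> * q)
          * window_sum (dyadic_mean (\<lambda>x. \<bar>f x\<bar> powr u)) k powr ((1 - \<theta>) * q / u))"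
      using L(2)[OF f' g'] unfolding X window_sum_dilate[OF g] by simp
  qed
qed

text \<open>The p-norm on the k-th annulus is 2^(k n / p) times the mean to the power
  \<open>1 / p\<close>; the quotient n / p moves into the weight.\<close>

lemma herz_norm_eq_dyadic:
  fixes f :: "'a::euclidean_space \<Rightarrow> real"
  assumes f: "continuous_on UNIV f" and p: "p > 0"
  shows "herz_norm \<alpha> p q f = epowr (\<Sum>\<^sub>\<infinity>k\<in>UNIV. ennreal (2 powr (real_of_int k * (real DIM('a) / p + \<alpha>) * q)
    * dyadic_mean (\<lambda>x. \<bar>f x\<bar> powr p) k powr (q / p))) (1 / q)"
proof -
  have "ennreal (2 powr (real_of_int k * \<alpha> * q)) * epowr (lp_norm p (annulus k) f) q
      = ennreal (2 powr (real_of_int k * (real DIM('a) / p + \<alpha>) * q) * dyadic_mean (\<lambda>x. \<bar>f x\<bar> powr p) k powr (q / p))" for k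
  proof -
    have "epowr (lp_norm p (annulus k) f) q
        = ennreal ((2 powr (real_of_int k * DIM('a)) * dyadic_mean (\<lambda>x. \<bar>f x\<bar> powr p) k) powr (q / p))"
      unfolding lp_norm_def nn_integral_annulus[OF continuous_on_abs_powr[OF f p]]
      by (simp add: epowr_ennreal powr_powr)
    also have "\<dots> = ennreal (2 powr (real_of_int k * (real DIM('a) / p) * q) * dyadic_mean (\<lambda>x. \<bar>f x\<bar> powr p) k powr (q / p))"
      by (simp add: powr_mult powr_powr)
    finally have *: "epowr (lp_norm p (annulus k) f) q = \<dots>" .
    have "2 powr (real_of_int k * (real DIM('a) / p + \<alpha>) * q)
        = 2 powr (real_of_int k * \<alpha> * q) * 2 powr (real_of_int k * (real DIM('a) / p) * q)"
      by (simp add: powr_add[symmetric] algebra_simps)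
    then show ?thesis
      unfolding * by (simp add: ennreal_mult mult.assoc)
  qed
  then show ?thesis unfolding herz_norm_def by simp
qed

text \<open>\<open>epowr\<close> sends only top to top, so a finite norm has a finite inner sum,
  whose real value bounds all finite partial sums.\<close>

lemma epowr_infsum_finite:
  fixes t :: "int \<Rightarrow> real"
  assumes fin: "epowr (\<Sum>\<^sub>\<infinity>k\<in>UNIV. ennreal (t k)) a < top" and t: "\<And>k. 0 \<le> t k"
  obtains S where "S \<ge> 0" "\<And>F. finite F \<Longrightarrow> (\<Sum>k\<in>F. t k) \<le> S"
    "enn2real (epowr (\<Sum>\<^sub>\<infinity>k\<in>UNIV. ennreal (t k)) a) = S powr a"
proof -
  define T where "T = (\<Sum>\<^sub>\<infinity>k\<in>UNIV. ennreal (t k))"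
  have "T \<noteq> top" using fin by (auto simp: T_def)
  then obtain S where S: "T = ennreal S" "S \<ge> 0" by (cases T) auto
  show ?thesis
  proof (rule that[OF S(2)])
    fix F :: "int set" assume "finite F"
    then have "(\<Sum>k\<in>F. ennreal (t k)) \<le> T"
      unfolding T_def by (subst nonneg_infsum_complete) (auto intro!: SUP_upper)
    then show "(\<Sum>k\<in>F. t k) \<le> S"
      using S t by simp
  next
    show "enn2real (epowr (\<Sum>\<^sub>\<infinity>k\<in>UNIV. ennreal (t k)) a) = S powr a"
      unfolding T_def[symmetric] S using S(2) by (simp add: epowr_ennreal)
  qed
qed

lemma epowr_infsum_le:
  fixes t :: "int \<Rightarrow> real"
  assumes t: "\<And>k. 0 \<le> t k" and S: "\<And>F. finite F \<Longrightarrow> (\<Sum>k\<in>F. t k) \<le> S" and a: "0 \<le> a"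
  shows "epowr (\<Sum>\<^sub>\<infinity>k\<in>UNIV. ennreal (t k)) a \<le> ennreal (S powr a)"
proof -
  have "0 \<le> S" using S[of "{}"] by simp
  have "(\<Sum>\<^sub>\<infinity>k\<in>UNIV. ennreal (t k)) \<le> ennreal S"
    using t S by (subst nonneg_infsum_complete) (auto intro!: SUP_least ennreal_leI)
  then show ?thesis
    using epowr_mono[OF _ a] epowr_ennreal[OF \<open>0 \<le> S\<close>] by metis
qed

text \<open>The pair of f and a continuous gradient g expresses that f is C1. At the endpoints of
  \<theta> a vanishing norm on the right may contribute \<open>0 powr 0 = 0\<close>, which makes the
  claim stronger but keeps it true: f then vanishes, being either of norm 0 or a constant of finite
  norm.\<close>

theorem theorem2p13:
  fixes u q v r s \<theta> \<alpha>1 \<alpha>2 \<alpha>3 \<sigma> :: real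
  assumes "u \<ge> 1" "q > 0" "v > 0" "r > 0" "s > 0" "0 \<le> \<theta>" "\<theta> \<le> 1"
    and "real DIM('a::euclidean_space) + \<alpha>2 > 0"
    and "real DIM('a) / u + \<alpha>3 > 0"
    and "real DIM('a) / q + \<alpha>1 > 0"
    and "\<sigma> \<le> \<alpha>2" "\<alpha>2 \<le> \<sigma> + 1"
    and "\<alpha>1 = \<theta> * \<sigma> + (1 - \<theta>) * \<alpha>3"
    and "real DIM('a) / q + \<alpha>1
           = \<theta> * (real DIM('a) + \<alpha>2 - 1) + (real DIM('a) / u + \<alpha>3) * (1 - \<theta>)"
    and "1 / r = \<theta> / s + (1 - \<theta>) / v"
  shows "\<exists>c>0. \<forall>(f :: 'a \<Rightarrow> real) (g :: 'a \<Rightarrow> 'a).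
           (\<forall>x. GDERIV f x :> g x) \<and> continuous_on UNIV g
           \<and> herz_norm \<alpha>2 1 s (\<lambda>x. norm (g x)) < top
           \<and> herz_norm \<alpha>3 u v f < top
           \<longrightarrow> herz_norm \<alpha>1 q r f
                 \<le> ennreal (c * enn2real (herz_norm \<alpha>2 1 s (\<lambda>x. norm (g x))) powr \<theta>
                              * enn2real (herz_norm \<alpha>3 u v f) powr (1 - \<theta>))"
proof -
  note pos = assms(1-7)
  have u: "u > 0" using pos by simp
  define n where "n = real DIM('a)"
  have n: "n \<ge> 1" unfolding n_def using DIM_positive[where 'a='a] by linarith
  \<comment> \<open>The gradient norm has weight \<open>n + \<alpha>2\<close> on means of |g|; one
    factor 2^k is already part of \<open>dyadic_gradient\<close>.\<close>
  define A where "A = n - 1 + \<alpha>2"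
  define B where "B = n / u + \<alpha>3"
  define \<kappa> where "\<kappa> = n / q + \<alpha>1"
  have B: "B > 0" and \<kappa>: "\<kappa> > 0" and \<kappa>AB: "\<kappa> = \<theta> * A + (1 - \<theta>) * B"
    using assms(9,10,14) by (simp_all add: A_def B_def \<kappa>_def n_def algebra_simps)
  define w where "w = (n - 1 + \<alpha>2 - \<sigma>) / n"
  have w: "0 \<le> w" "real DIM('a) - 1 \<le> real DIM('a) * w"
    using n assms(11) by (auto simp: w_def n_def[symmetric])
  \<comment> \<open>Subtracting the formula for \<alpha>1 from the scaling identity eliminates
    \<alpha>3.\<close>
  have "n / q = \<theta> * (n - 1 + \<alpha>2 - \<sigma>) + (1 - \<theta>) * (n / u)"
    using assms(13,14) by (simp add: n_def[symmetric] algebra_simps)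
  also have "\<dots> = n * (\<theta> * w + (1 - \<theta>) / u)"
    using n by (simp add: w_def field_simps)
  finally have "n * (1 / q) = n * (\<theta> * w + (1 - \<theta>) / u)" by simp
  then have qw: "1 / q = \<theta> * w + (1 - \<theta>) / u"
    using n by (subst (asm) mult_cancel_left) auto
  define m where "m = min \<kappa> B"
  have m: "m > 0" using \<kappa> B by (simp add: m_def)
  \<comment> \<open>The scaled sum inequality is used twice, for the power q inside the integrals
    and for the power \<open>r / q\<close> of the means. Each use gets a quarter of the rate, so
    that together they yield \<open>2 powr (r * m / 2)\<close>.\<close>
  define \<delta> where "\<delta> = 2 powr (q * m / 4)"
  define \<delta>' where "\<delta>' = 2 powr (r * m / 4)"
  have \<delta>: "\<delta> > 1" "\<delta>' > 1"
    using pos m by (auto simp: \<delta>_def \<delta>'_def)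
  have \<eta>: "\<delta>' * \<delta> powr (r / q) = 2 powr (r * min \<kappa> B / 2)"
    using pos by (simp add: \<delta>_def \<delta>'_def m_def powr_powr powr_add[symmetric])
  obtain K L where K: "K \<ge> 0" and L: "L \<ge> 0"
    and rec: "\<And>(f :: 'a \<Rightarrow> real) g k. (\<And>x. GDERIV f x :> g x) \<Longrightarrow> continuous_on UNIV g \<Longrightarrow>
      dyadic_mean (\<lambda>x. \<bar>f x\<bar> powr q) k \<le> \<delta> * dyadic_mean (\<lambda>x. \<bar>f x\<bar> powr q) (k + 1)
        + K * (window_sum (dyadic_gradient g) k powr (\<theta> * q)
          * window_sum (dyadic_mean (\<lambda>x. \<bar>f x\<bar> powr u)) k powr ((1 - \<theta>) * q / u))"
    and bd: "\<And>(f :: 'a \<Rightarrow> real) g k. (\<And>x. GDERIV f x :> g x) \<Longrightarrow> continuous_on UNIV g \<Longrightarrow>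
      dyadic_mean (\<lambda>x. \<bar>f x\<bar> powr q) k
      \<le> L * ((window_sum (dyadic_gradient g) k + window_sum (dyadic_mean (\<lambda>x. \<bar>f x\<bar> powr u)) k powr (1 / u)) powr (\<theta> * q)
          * window_sum (dyadic_mean (\<lambda>x. \<bar>f x\<bar> powr u)) k powr ((1 - \<theta>) * q / u))"
    using dyadic_estimates[OF pos(2,1,6,7) w qw \<delta>(1)] by blast
  obtain K' where K': "K' \<ge> 0"
    "\<And>a b. a \<ge> 0 \<Longrightarrow> b \<ge> 0 \<Longrightarrow> (a + b) powr (r / q) \<le> \<delta>' * a powr (r / q) + K' * b powr (r / q)"
    using powr_add_le_powr_scaled[OF \<delta>(2), of "r / q"] pos by auto
  \<comment> \<open>The cost of replacing single annuli by windows, with power s for the gradient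
    means and \<open>v / u\<close> for the means of the power u of |f|.\<close>
  define cP where "cP = 4 powr s * 4 * 2 powr (2 * \<bar>A * s\<bar>)"
  define cQ where "cQ = 4 powr (v / u) * 4 * 2 powr (2 * \<bar>B * v\<bar>)"
  define cK where "cK = K' * K powr (r / q) / (1 - 2 powr (r * min \<kappa> B / 2 - \<kappa> * r))"
  define c where "c = (cK * (cP powr (\<theta> * r / s) * cQ powr ((1 - \<theta>) * r / v))) powr (1 / r)"
  have "r * min \<kappa> B / 2 - \<kappa> * r < 0"
    using pos \<kappa> mult_left_mono[of "min \<kappa> B" \<kappa> r] mult_pos_pos[OF pos(4) \<kappa>] by (simp add: mult.commute)
  then have "2 powr (r * min \<kappa> B / 2 - \<kappa> * r) < 1" by (simp add: powr_less_one)
  then have cK: "cK \<ge> 0" using K K' by (simp add: cK_def)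
  have main: "herz_norm \<alpha>1 q r f
      \<le> ennreal (c * enn2real (herz_norm \<alpha>2 1 s (\<lambda>x. norm (g x))) powr \<theta>
                   * enn2real (herz_norm \<alpha>3 u v f) powr (1 - \<theta>))"
    if f: "\<And>x. GDERIV f x :> g x" and g: "continuous_on UNIV g"
      and fin1: "herz_norm \<alpha>2 1 s (\<lambda>x. norm (g x)) < top" and fin2: "herz_norm \<alpha>3 u v f < top"
    for f :: "'a \<Rightarrow> real" and g :: "'a \<Rightarrow> 'a"
  proof -
    have fc: "continuous_on UNIV f" by (rule GDERIV_continuous_on[OF f])
    define X where "X = dyadic_mean (\<lambda>x. \<bar>f x\<bar> powr q)"
    define U where "U = dyadic_mean (\<lambda>x. \<bar>f x\<bar> powr u)"
    define D where "D = dyadic_gradient g"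
    have nn: "0 \<le> X k" "0 \<le> U k" "0 \<le> D k" for k by (auto simp: X_def U_def D_def)
    have wnn: "0 \<le> window_sum D k" "0 \<le> window_sum U k" for k
      using nn by (auto intro!: window_sum_nonneg)
    have hX: "herz_norm \<alpha>1 q r f = epowr (\<Sum>\<^sub>\<infinity>k\<in>UNIV. ennreal (2 powr (real_of_int k * \<kappa> * r) * X k powr (r / q))) (1 / r)"
      unfolding X_def \<kappa>_def n_def by (rule herz_norm_eq_dyadic[OF fc pos(2)])
    have hU: "herz_norm \<alpha>3 u v f = epowr (\<Sum>\<^sub>\<infinity>k\<in>UNIV. ennreal (2 powr (real_of_int k * (B * v)) * U k powr (v / u))) (1 / v)"
      unfolding U_def B_def n_def herz_norm_eq_dyadic[OF fc u] by (simp add: mult.assoc)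
    have hD: "herz_norm \<alpha>2 1 s (\<lambda>x. norm (g x)) = epowr (\<Sum>\<^sub>\<infinity>k\<in>UNIV. ennreal (2 powr (real_of_int k * (A * s)) * D k powr s)) (1 / s)"
    proof -
      have "2 powr (real_of_int k * (real DIM('a) / 1 + \<alpha>2) * s) * dyadic_mean (\<lambda>x. \<bar>norm (g x)\<bar> powr 1) k powr (s / 1)
          = 2 powr (real_of_int k * (A * s)) * D k powr s" for k
      proof -
        have "2 powr (real_of_int k * (real DIM('a) / 1 + \<alpha>2) * s) = 2 powr (real_of_int k * (A * s)) * 2 powr (real_of_int k * s)"
          by (simp add: A_def n_def powr_add[symmetric] algebra_simps)
        then show ?thesis
          by (simp add: D_def dyadic_gradient_def powr_mult powr_powr)
      qed
      then show ?thesis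
        using herz_norm_eq_dyadic[OF continuous_on_norm[OF g], of 1 \<alpha>2 s] by simp
    qed
    obtain P where P: "P \<ge> 0" "\<And>F. finite F \<Longrightarrow> (\<Sum>k\<in>F. 2 powr (real_of_int k * (A * s)) * D k powr s) \<le> P"
      "enn2real (herz_norm \<alpha>2 1 s (\<lambda>x. norm (g x))) = P powr (1 / s)"
      using epowr_infsum_finite[OF fin1[unfolded hD]] unfolding hD by auto
    obtain Q where Q: "Q \<ge> 0" "\<And>F. finite F \<Longrightarrow> (\<Sum>k\<in>F. 2 powr (real_of_int k * (B * v)) * U k powr (v / u)) \<le> Q"
      "enn2real (herz_norm \<alpha>3 u v f) = Q powr (1 / v)"
      using epowr_infsum_finite[OF fin2[unfolded hU]] unfolding hU by auto
    have "(\<Sum>k\<in>F. 2 powr (real_of_int k * \<kappa> * r) * X k powr (r / q))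
        \<le> cK * ((cP * P) powr (\<theta> * r / s) * (cQ * Q) powr ((1 - \<theta>) * r / v))" if F: "finite F" for F
      unfolding cK_def
    \<comment> \<open>All sequences are brought to the right homogeneity:
      \<open>X k powr (r / q)\<close> for x and the power \<open>1 / u\<close> for the window of f.
      The exponents \<open>\<theta> * q\<close> and \<open>(1 - \<theta>) * q / u\<close> then
      become \<open>\<theta> * r\<close> and \<open>(1 - \<theta>) * r\<close>.\<close>
    proof (rule dyadic_sequence_interpolation[where a = "window_sum D" and e = "\<lambda>k. window_sum U k powr (1 / u)"
          and A = A and L = "L powr (r / q)", OF pos(4,5,3,6,7) assms(15) \<kappa>AB \<kappa> B])
      fix k
      have "X k powr (r / q) \<le> (\<delta> * X (k + 1) + K * (window_sum D k powr (\<theta> * q) * window_sum U k powr ((1 - \<theta>) * q / u))) powr (r / q)"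
        using pos nn rec[OF f g] unfolding X_def D_def U_def by (intro powr_mono2) auto
      also have "\<dots> \<le> \<delta>' * (\<delta> * X (k + 1)) powr (r / q) + K' * (K * (window_sum D k powr (\<theta> * q) * window_sum U k powr ((1 - \<theta>) * q / u))) powr (r / q)"
        using \<delta> nn K by (intro K') auto
      also have "\<dots> = (\<delta>' * \<delta> powr (r / q)) * X (k + 1) powr (r / q)
          + K' * K powr (r / q) * (window_sum D k powr (\<theta> * r) * (window_sum U k powr (1 / u)) powr ((1 - \<theta>) * r))"
        using \<delta> nn K pos by (simp add: powr_mult powr_powr)
      finally show "X k powr (r / q) \<le> 2 powr (r * min \<kappa> B / 2) * X (k + 1) powr (r / q)
          + K' * K powr (r / q) * (window_sum D k powr (\<theta> * r) * (window_sum U k powr (1 / u)) powr ((1 - \<theta>) * r))"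
        unfolding \<eta> .
      have "X k powr (r / q) \<le> (L * ((window_sum D k + window_sum U k powr (1 / u)) powr (\<theta> * q) * window_sum U k powr ((1 - \<theta>) * q / u))) powr (r / q)"
        using pos nn bd[OF f g] unfolding X_def D_def U_def by (intro powr_mono2) auto
      also have "\<dots> = L powr (r / q) * ((window_sum D k + window_sum U k powr (1 / u)) powr (\<theta> * r) * (window_sum U k powr (1 / u)) powr ((1 - \<theta>) * r))"
        using L pos by (simp add: powr_mult powr_powr)
      finally show "X k powr (r / q) \<le> L powr (r / q) * ((window_sum D k + window_sum U k powr (1 / u)) powr (\<theta> * r) * (window_sum U k powr (1 / u)) powr ((1 - \<theta>) * r))" .
    next
      fix F :: "int set" assume F: "finite F"
      have "(\<Sum>k\<in>F. (2 powr (real_of_int k * A) * window_sum D k) powr s) = (\<Sum>k\<in>F. 2 powr (real_of_int k * (A * s)) * window_sum D k powr s)"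
        using wnn by (simp add: powr_mult powr_powr mult.assoc)
      also have "\<dots> \<le> cP * P"
        unfolding cP_def using nn pos P(2) F by (intro weighted_window_sum_le) auto
      finally show "(\<Sum>k\<in>F. (2 powr (real_of_int k * A) * window_sum D k) powr s) \<le> cP * P" .
      have "(\<Sum>k\<in>F. (2 powr (real_of_int k * B) * window_sum U k powr (1 / u)) powr v) = (\<Sum>k\<in>F. 2 powr (real_of_int k * (B * v)) * window_sum U k powr (v / u))"
        using wnn by (simp add: powr_mult powr_powr mult.assoc)
      also have "\<dots> \<le> cQ * Q"
        unfolding cQ_def using nn pos u Q(2) F by (intro weighted_window_sum_le) auto
      finally show "(\<Sum>k\<in>F. (2 powr (real_of_int k * B) * window_sum U k powr (1 / u)) powr v) \<le> cQ * Q" .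
    qed (use wnn K' F in auto)
    then have "herz_norm \<alpha>1 q r f \<le> ennreal ((cK * ((cP * P) powr (\<theta> * r / s) * (cQ * Q) powr ((1 - \<theta>) * r / v))) powr (1 / r))"
      unfolding hX using pos nn by (intro epowr_infsum_le) auto
    also have "(cK * ((cP * P) powr (\<theta> * r / s) * (cQ * Q) powr ((1 - \<theta>) * r / v))) powr (1 / r)
        = c * (P powr (1 / s)) powr \<theta> * (Q powr (1 / v)) powr (1 - \<theta>)"
      using pos cK P(1) Q(1) by (simp add: c_def cP_def cQ_def powr_mult powr_powr)
    finally show ?thesis unfolding P(3) Q(3) .
  qed
  show ?thesis
  \<comment> \<open>c is only known to be nonnegative, whereas a positive constant is
    claimed.\<close>
  proof (intro exI[of _ "c + 1"] conjI allI impI)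
    show "0 < c + 1" by (simp add: c_def add_nonneg_pos)
    fix f :: "'a \<Rightarrow> real" and g :: "'a \<Rightarrow> 'a"
    assume "(\<forall>x. GDERIV f x :> g x) \<and> continuous_on UNIV g
           \<and> herz_norm \<alpha>2 1 s (\<lambda>x. norm (g x)) < top \<and> herz_norm \<alpha>3 u v f < top"
    then have "herz_norm \<alpha>1 q r f
      \<le> ennreal (c * enn2real (herz_norm \<alpha>2 1 s (\<lambda>x. norm (g x))) powr \<theta>
                   * enn2real (herz_norm \<alpha>3 u v f) powr (1 - \<theta>))"
      by (intro main) auto
    also have "\<dots> \<le> ennreal ((c + 1) * enn2real (herz_norm \<alpha>2 1 s (\<lambda>x. norm (g x))) powr \<theta>
                   * enn2real (herz_norm \<alpha>3 u v f) powr (1 - \<theta>))"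
      by (intro ennreal_leI mult_right_mono) auto
    finally show "herz_norm \<alpha>1 q r f
      \<le> ennreal ((c + 1) * enn2real (herz_norm \<alpha>2 1 s (\<lambda>x. norm (g x))) powr \<theta>
                   * enn2real (herz_norm \<alpha>3 u v f) powr (1 - \<theta>))" .
  qed
qed

end
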